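(* For any $u\ge 2$ and $K\ge\Omega(SA)$, one can construct a set of stochastic path problem instances (with $S$ states and $A$ actions) such that $R\le u$ for all instances in the set, and there exists a distribution over these instances such that the expected regret over $K$ episodes of any learning algorithm is at least $\Omega(u\sqrt{SAK})$.
   Context: $\Omega(\cdot)$ hides universal constants. Stochastic path (SP) problem: finite state set $\mathcal S$ ($S=|\mathcal S|$), finite action set $\mathcal A$ ($A=|\mathcal A|$), initial state $s_{\mathrm{init}}\in\mathcal S$ (or, equivalently up to adding one state, an initial state distribution), terminal state $g\notin\mathcal S$, transition kernel $P:\mathcal S\times\mathcal A\to\Delta_{\mathcal S\cup\{g\}}$, reward $r:\mathcal S\times\mathcal A\to[-1,1]$. In an episode, $s_1=s_{\mathrm{init}}$; at step $i$ the player in state $s_i$ takes action $a_i$, gets $r(s_i,a_i)$, and $s_{i+1}\sim P_{s_i,a_i}$; the episode ends upon reaching $g$. Let $\tau=\min\{i:s_{i+1}=g\}$. $\Pi^{\mathrm{HD}}$ is the set of history-dependent deterministic policies. $V^\pi(s)=\mathbb E^\pi[\sum_{i=1}^\tau r(s_i,a_i)\mid s_1=s]$. Standing assumption on SP instances: all policies in $\Pi^{\mathrm{HD}}$ are proper (they reach $g$ with probability 1 from every state); then a stationary deterministic policy $\pi^\star$ is optimal from all states, and $V^\star=V^{\pi^\star}$. Define $R=\sup_{\pi\in\Pi^{\mathrm{HD}}}\sqrt{\mathbb E^\pi[(\sum_{i=1}^\tau r(s_i,a_i))^2\mid s_1=s_{\mathrm{init}}]}$. Learning protocol: the learner knows $r$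 but not $P$ and interacts for $K$ episodes, each starting at $s_{\mathrm{init}}$; time $t$ counts steps across episodes, episode $k$ occupies times $t_k,\dots,e_k$, and the regret is $\mathrm{Reg}_K=\sum_{k=1}^K\bigl(V^\star(s_{\mathrm{init}})-\sum_{t=t_k}^{e_k}r(s_t,a_t)\bigr)$. The expected regret is over the draw of the instance, the transitions, and the algorithm's randomness.
   Formalization: The number of actions A is assumed to be at least 2: for A = 1 there is only one policy, so the expected regret of every learning algorithm is 0 and the claimed lower bound fails. *)

theory Defs
  imports "HOL-Probability.Probability"
begin

text \<open>
  Stochastic path problems. The terminal state \<open>g\<close>, which is not a state, is \<open>None\<close> in \<open>'s option\<close>.
\<close>

record ('s, 'a) sp =
  states :: "'s set"
  actions :: "'a set"
  init :: 's
  kernel :: "'s \<Rightarrow> 'a \<Rightarrow> 's option pmf"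
  reward :: "'s \<Rightarrow> 'a \<Rightarrow> real"

text \<open>
  A step \<open>(s\<^sub>t, a\<^sub>t, s')\<close> also records the outcome \<open>s'\<close> of the transition, because a history running over
  several episodes must show where episodes end. Times and episodes are numbered from \<open>0\<close>.
\<close>

type_synonym ('s, 'a) step = "'s \<times> 'a \<times> 's option"

type_synonym ('s, 'a) history = "('s, 'a) step list"

fun outcome :: "('s, 'a) step \<Rightarrow> 's option" where
  "outcome (s, a, s') = s'"

fun step_reward :: "('s \<Rightarrow> 'a \<Rightarrow> real) \<Rightarrow> ('s, 'a) step \<Rightarrow> real" where
  "step_reward r (s, a, s') = r s a"

text \<open>
  \<open>run M s\<^sub>0 \<sigma>\<close> is the law of the infinite sequence of steps when action \<open>a\<^sub>t\<close> is drawn from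
  \<open>\<sigma> h s\<^sub>t\<close>, \<open>h\<close> being the list of all earlier steps, and when a new episode is started in \<open>s\<^sub>0\<close>
  each time the terminal state is reached. It is obtained from the one-step transition laws
  by the Ionescu-Tulcea theorem. The same process serves for a policy within a single episode
  (episode \<open>0\<close>, whose law does not depend on what happens after it) and for a learner that
  interacts over many episodes.
\<close>

definition current_state :: "'s \<Rightarrow> ('s, 'a) history \<Rightarrow> 's" where
  "current_state s\<^sub>0 h =
     (if h = [] then s\<^sub>0 else case outcome (last h) of None \<Rightarrow> s\<^sub>0 | Some s \<Rightarrow> s)"

definition next_step ::
    "('s, 'a) sp \<Rightarrow> 's \<Rightarrow> (('s, 'a) history \<Rightarrow> 's \<Rightarrow> 'a pmf) \<Rightarrow> ('s, 'a) history \<Rightarrow> ('s, 'a) step pmf"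
  where
  "next_step M s\<^sub>0 \<sigma> h =
     (let s = current_state s\<^sub>0 h
      in bind_pmf (\<sigma> h s) (\<lambda>a. map_pmf (\<lambda>s'. (s, a, s')) (kernel M s a)))"

definition step_law ::
    "('s, 'a) sp \<Rightarrow> 's \<Rightarrow> (('s, 'a) history \<Rightarrow> 's \<Rightarrow> 'a pmf) \<Rightarrow>
     nat \<Rightarrow> (nat \<Rightarrow> ('s, 'a) step) \<Rightarrow> ('s, 'a) step measure" where
  "step_law M s\<^sub>0 \<sigma> n \<omega> = measure_pmf (next_step M s\<^sub>0 \<sigma> (map \<omega> [0..<n]))"

definition run ::
    "('s::countable, 'a::countable) sp \<Rightarrow> 's \<Rightarrow> (('s, 'a) history \<Rightarrow> 's \<Rightarrow> 'a pmf) \<Rightarrow>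
     (nat \<Rightarrow> ('s, 'a) step) measure" where
  "run M s\<^sub>0 \<sigma> = projective_family.lim UNIV
     (Ionescu_Tulcea.CI (step_law M s\<^sub>0 \<sigma>) (\<lambda>_. count_space UNIV)) (\<lambda>_. count_space UNIV)"

lemma Ionescu_Tulcea_step_law:
  fixes M :: "('s::countable, 'a::countable) sp"
  shows "Ionescu_Tulcea (step_law M s\<^sub>0 \<sigma>) (\<lambda>_. count_space UNIV)"
proof (rule Ionescu_Tulcea.intro, goal_cases)
  case (1 n)
  have "PiM {0..<n} (\<lambda>_. count_space (UNIV :: ('s, 'a) step set))
      = count_space (PiE {0..<n} (\<lambda>_. UNIV))"
    by (rule count_space_PiM_finite) simp_all
  then show ?case
    by (simp add: step_law_def space_subprob_algebra measure_pmf.subprob_space_axioms)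
next
  case (2 n \<omega>)
  show ?case
    unfolding step_law_def by (rule measure_pmf.prob_space_axioms)
qed

lemma sets_run: "sets (run M s\<^sub>0 \<sigma>) = sets (PiM UNIV (\<lambda>_. count_space UNIV))"
proof -
  interpret Ionescu_Tulcea "step_law M s\<^sub>0 \<sigma>" "\<lambda>_. count_space UNIV"
    by (rule Ionescu_Tulcea_step_law)
  show ?thesis unfolding run_def by (rule PF.sets_lim)
qed

lemma prob_space_run: "prob_space (run M s\<^sub>0 \<sigma>)"
proof -
  interpret Ionescu_Tulcea "step_law M s\<^sub>0 \<sigma>" "\<lambda>_. count_space UNIV"
    by (rule Ionescu_Tulcea_step_law)
  let ?N = "PiM {} (\<lambda>_::nat. count_space UNIV)"
  have "prob_space (CI {})"
    by (rule PF.prob_space_P) simp_all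
  then have "prob_space (distr PF.lim ?N (\<lambda>x. restrict x {}))"
    by (simp only: distr_lim[OF finite.emptyI])
  moreover have "(\<lambda>x. restrict x {}) \<in> measurable PF.lim ?N"
    unfolding measurable_cong_sets[OF PF.sets_lim refl] by (rule measurable_restrict_subset) simp
  ultimately have "prob_space PF.lim"
    by (rule prob_space_distrD[rotated])
  then show ?thesis unfolding run_def .
qed

text \<open>
  Episode \<open>k\<close> occupies the times \<open>episode_start \<omega> k, \<dots>, episode_end \<omega> k\<close>; in particular
  \<open>episode_end \<omega> 0\<close> is the time \<open>\<tau>\<close> of the first episode. If some episode does not terminate
  these values are arbitrary.
\<close>

definition end_from :: "(nat \<Rightarrow> ('s, 'a) step) \<Rightarrow> nat \<Rightarrow> nat" where
  "end_from \<omega> t = (LEAST i. t \<le> i \<and> outcome (\<omega> i) = None)"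

primrec episode_start :: "(nat \<Rightarrow> ('s, 'a) step) \<Rightarrow> nat \<Rightarrow> nat" where
  "episode_start \<omega> 0 = 0"
| "episode_start \<omega> (Suc k) = Suc (end_from \<omega> (episode_start \<omega> k))"

definition episode_end :: "(nat \<Rightarrow> ('s, 'a) step) \<Rightarrow> nat \<Rightarrow> nat" where
  "episode_end \<omega> k = end_from \<omega> (episode_start \<omega> k)"

definition episode_return ::
    "('s \<Rightarrow> 'a \<Rightarrow> real) \<Rightarrow> (nat \<Rightarrow> ('s, 'a) step) \<Rightarrow> nat \<Rightarrow> real" where
  "episode_return r \<omega> k = (\<Sum>t = episode_start \<omega> k..episode_end \<omega> k. step_reward r (\<omega> t))"

text \<open>
  Within an episode the recorded outcomes are just the successive states, so a policy sees
  \<open>s\<^sub>0, a\<^sub>0, \<dots>, s\<^sub>t\<close> and nothing else.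
\<close>

type_synonym ('s, 'a) policy = "('s, 'a) history \<Rightarrow> 's \<Rightarrow> 'a"

definition HD_policies :: "('s, 'a) sp \<Rightarrow> ('s, 'a) policy set" where
  "HD_policies M = {\<pi>. \<forall>h. \<forall>s\<in>states M. \<pi> h s \<in> actions M}"

definition policy_run ::
    "('s::countable, 'a::countable) sp \<Rightarrow> ('s, 'a) policy \<Rightarrow> 's \<Rightarrow> (nat \<Rightarrow> ('s, 'a) step) measure" where
  "policy_run M \<pi> s = run M s (\<lambda>h x. return_pmf (\<pi> h x))"

definition proper :: "('s::countable, 'a::countable) sp \<Rightarrow> ('s, 'a) policy \<Rightarrow> bool" where
  "proper M \<pi> \<longleftrightarrow> (\<forall>s\<in>states M. AE \<omega> in policy_run M \<pi> s. \<exists>t. outcome (\<omega> t) = None)"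

definition sp_instance :: "('s::countable, 'a::countable) sp \<Rightarrow> bool" where
  "sp_instance M \<longleftrightarrow>
     finite (states M) \<and> finite (actions M) \<and> actions M \<noteq> {} \<and> init M \<in> states M \<and>
     (\<forall>s\<in>states M. \<forall>a\<in>actions M.
        set_pmf (kernel M s a) \<subseteq> insert None (Some ` states M) \<and> reward M s a \<in> {-1..1}) \<and>
     (\<forall>\<pi>\<in>HD_policies M. proper M \<pi>)"

definition policy_value ::
    "('s::countable, 'a::countable) sp \<Rightarrow> ('s, 'a) policy \<Rightarrow> 's \<Rightarrow> real" where
  "policy_value M \<pi> s = (\<integral>\<omega>. episode_return (reward M) \<omega> 0 \<partial>policy_run M \<pi> s)"

definition optimal_stationary ::
    "('s::countable, 'a::countable) sp \<Rightarrow> ('s \<Rightarrow> 'a) \<Rightarrow> bool" where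
  "optimal_stationary M f \<longleftrightarrow>
     (\<forall>s\<in>states M. f s \<in> actions M) \<and>
     (\<forall>s\<in>states M. \<forall>\<pi>\<in>HD_policies M. policy_value M \<pi> s \<le> policy_value M (\<lambda>_. f) s)"

text \<open>
  For an \<open>sp_instance\<close> an optimal stationary policy exists, and the value on \<open>states M\<close> does not
  depend on which one is chosen.
\<close>

definition optimal_value :: "('s::countable, 'a::countable) sp \<Rightarrow> 's \<Rightarrow> real" where
  "optimal_value M s = policy_value M (\<lambda>_. SOME f. optimal_stationary M f) s"

text \<open>
  The quantity \<open>R\<close> is taken in the extended nonnegative reals, so that a bound on it
  includes finiteness of all second moments and of their supremum.
\<close>

definition ennreal_sqrt :: "ennreal \<Rightarrow> ennreal" where
  "ennreal_sqrt x = (if x = \<infinity> then \<infinity> else ennreal (sqrt (enn2real x)))"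

definition return_scale :: "('s::countable, 'a::countable) sp \<Rightarrow> ennreal" where
  "return_scale M = (SUP \<pi>\<in>HD_policies M. ennreal_sqrt
     (\<integral>\<^sup>+\<omega>. ennreal ((episode_return (reward M) \<omega> 0)\<^sup>2) \<partial>policy_run M \<pi> (init M)))"

text \<open>
  A randomized learning algorithm chooses each action given the reward function and the whole
  history of all episodes so far, but not the kernel.
\<close>

type_synonym ('s, 'a) learner = "('s \<Rightarrow> 'a \<Rightarrow> real) \<Rightarrow> ('s, 'a) history \<Rightarrow> 's \<Rightarrow> 'a pmf"

definition learning_algorithm :: "'s set \<Rightarrow> 'a set \<Rightarrow> ('s, 'a) learner \<Rightarrow> bool" where
  "learning_algorithm X B L \<longleftrightarrow> (\<forall>r h. \<forall>s\<in>X. set_pmf (L r h s) \<subseteq> B)"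

definition regret ::
    "('s::countable, 'a::countable) sp \<Rightarrow> nat \<Rightarrow> (nat \<Rightarrow> ('s, 'a) step) \<Rightarrow> real" where
  "regret M K \<omega> = (\<Sum>k<K. optimal_value M (init M) - episode_return (reward M) \<omega> k)"

definition expected_regret ::
    "('s::countable, 'a::countable) sp \<Rightarrow> nat \<Rightarrow> ('s, 'a) learner \<Rightarrow> real" where
  "expected_regret M K L = (\<integral>\<omega>. regret M K \<omega> \<partial>run M (init M) (L (reward M)))"

end

theory Submission
  imports Defs
begin

text \<open>
  All rewards are \<open>1\<close>, so an episode's return is its length. In every state one secret action ends
  the episode with probability \<open>p = 3 / (2 u)\<close>, all others with probability \<open>p (1 + d)\<close>; otherwise
  the next state is uniform. Lengths of episodes are of order \<open>u\<close>, each step that misses the secret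
  action costs \<open>d\<close>, and each step yields information of order \<open>p d\<^sup>2\<close> about a single secret.
  The \<open>K\<close> episodes last about \<open>K / p\<close> steps, so with \<open>d\<close> of order \<open>sqrt (S A / K)\<close> the learner
  cannot identify the \<open>S\<close> uniformly random secrets and pays \<open>d K / p\<close>, which is of order
  \<open>u sqrt (S A K)\<close>.

  That cost is exact: the number of terminations minus the accumulated exit probability is a
  martingale, so the expected total length of the \<open>K\<close> episodes is \<open>K / p\<close> minus \<open>d\<close> times the
  expected number of misses. To bound hits in state \<open>s\<close>, the law is compared with
  the one in which \<open>s\<close> has no secret action. Only visits caused by a jump are counted, since the
  target of a jump is independent of the past, which turns the comparison into one weighted by
  \<open>1 / S\<close>.
\<close>

section \<open>Finite histories\<close>

text \<open>The quantitative estimates are made on this discrete law; \<open>nn_integral_run\<close>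
  identifies it with a marginal of the infinite process.\<close>

primrec history_pmf ::
    "('s, 'a) sp \<Rightarrow> 's \<Rightarrow> (('s, 'a) history \<Rightarrow> 's \<Rightarrow> 'a pmf) \<Rightarrow> nat \<Rightarrow> ('s, 'a) history pmf" where
  "history_pmf M s\<^sub>0 \<sigma> 0 = return_pmf []"
| "history_pmf M s\<^sub>0 \<sigma> (Suc n) =
     bind_pmf (history_pmf M s\<^sub>0 \<sigma> n) (\<lambda>h. map_pmf (\<lambda>x. h @ [x]) (next_step M s\<^sub>0 \<sigma> h))"

lemma length_history_pmf: "h \<in> set_pmf (history_pmf M s\<^sub>0 \<sigma> n) \<Longrightarrow> length h = n"
  by (induction n arbitrary: h) auto

text \<open>The marginal of the projective limit on \<open>{0..<n}\<close> is the composition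
  \<open>C 0 n\<close> of the step kernels, which obeys the recursion defining
  \<open>history_pmf\<close>.\<close>

lemma nn_integral_run:
  fixes M :: "('s::countable, 'a::countable) sp" and f :: "('s, 'a) history \<Rightarrow> ennreal"
  shows "(\<integral>\<^sup>+\<omega>. f (map \<omega> [0..<n]) \<partial>run M s\<^sub>0 \<sigma>) = (\<integral>\<^sup>+h. f h \<partial>history_pmf M s\<^sub>0 \<sigma> n)"
proof -
  interpret Ionescu_Tulcea "step_law M s\<^sub>0 \<sigma>" "\<lambda>_. count_space UNIV"
    by (rule Ionescu_Tulcea_step_law)
  let ?P = "\<lambda>n::nat. PiM {0..<n} (\<lambda>_. count_space (UNIV :: ('s, 'a) step set))"
  let ?u = "\<lambda>_::nat. undefined :: ('s, 'a) step"
  have "?P n = count_space (PiE {0..<n} (\<lambda>_. UNIV))" for n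
    by (rule count_space_PiM_finite) simp_all
  then have meas: "(\<lambda>\<omega>. g (map \<omega> [0..<n])) \<in> borel_measurable (?P n)"
    for g :: "('s, 'a) history \<Rightarrow> ennreal" and n
    by simp
  have u: "?u \<in> space (?P 0)" by (simp add: space_PiM)
  \<comment> \<open>\<open>f\<close> stays general because the induction step applies the claim to
    the integral of \<open>f\<close> over the last step. The start \<open>?u\<close> is the only
    point of the empty product.\<close>
  have C: "(\<integral>\<^sup>+\<omega>. f (map \<omega> [0..<n]) \<partial>C 0 n ?u) = (\<integral>\<^sup>+h. f h \<partial>history_pmf M s\<^sub>0 \<sigma> n)" for f n
  proof (induction n arbitrary: f)
    case 0
    show ?case using u by (simp add: nn_integral_return)
  next
    case (Suc n)
    have "(\<integral>\<^sup>+\<omega>. f (map \<omega> [0..<Suc n]) \<partial>C 0 (Suc n) ?u)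
        = (\<integral>\<^sup>+\<omega>. \<integral>\<^sup>+\<omega>'. f (map \<omega>' [0..<Suc n]) \<partial>eP n \<omega> \<partial>C 0 n ?u)"
    proof -
      have sets: "sets (C 0 n ?u) = sets (?P n)" using sets_C[OF u, of n] by simp
      have "eP n \<in> C 0 n ?u \<rightarrow>\<^sub>M subprob_algebra (?P (Suc n))"
        unfolding measurable_cong_sets[OF sets refl] by (rule measurable_eP)
      then show ?thesis
        by (simp add: nn_integral_bind[OF meas] del: upt_Suc)
    qed
    also have "\<dots> = (\<integral>\<^sup>+\<omega>. \<integral>\<^sup>+x. f (map \<omega> [0..<n] @ [x]) \<partial>step_law M s\<^sub>0 \<sigma> n \<omega> \<partial>C 0 n ?u)"
    proof (rule nn_integral_cong)
      fix \<omega> assume "\<omega> \<in> space (C 0 n ?u)"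
      then have "\<omega> \<in> space (?P n)" using space_C[OF u, of n] by simp
      then have "(\<integral>\<^sup>+\<omega>'. f (map \<omega>' [0..<Suc n]) \<partial>eP n \<omega>)
          = (\<integral>\<^sup>+x. f (map (fun_upd \<omega> n x) [0..<Suc n]) \<partial>step_law M s\<^sub>0 \<sigma> n \<omega>)"
        by (rule nn_integral_eP[OF _ meas])
      also have "\<dots> = (\<integral>\<^sup>+x. f (map \<omega> [0..<n] @ [x]) \<partial>step_law M s\<^sub>0 \<sigma> n \<omega>)"
        by simp
      finally show "(\<integral>\<^sup>+\<omega>'. f (map \<omega>' [0..<Suc n]) \<partial>eP n \<omega>)
          = (\<integral>\<^sup>+x. f (map \<omega> [0..<n] @ [x]) \<partial>step_law M s\<^sub>0 \<sigma> n \<omega>)" .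
    qed
    also have "\<dots> = (\<integral>\<^sup>+h. \<integral>\<^sup>+x. f (h @ [x]) \<partial>next_step M s\<^sub>0 \<sigma> h \<partial>history_pmf M s\<^sub>0 \<sigma> n)"
      using Suc.IH[of "\<lambda>h. \<integral>\<^sup>+x. f (h @ [x]) \<partial>next_step M s\<^sub>0 \<sigma> h"]
      unfolding step_law_def[of M s\<^sub>0 \<sigma> n] .
    also have "\<dots> = (\<integral>\<^sup>+h. f h \<partial>history_pmf M s\<^sub>0 \<sigma> (Suc n))"
      by simp
    finally show ?case .
  qed
  have CI: "distr PF.lim (?P n) (\<lambda>\<omega>. restrict \<omega> {0..<n}) = C 0 n ?u"
  proof -
    have "up_to {0..<n} = n"
      by (metis (no_types) up_to_iff_Ico[OF finite_atLeastLessThan] order_antisym atLeastLessThan_subset_iff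
          le_zero_eq not_le order_refl zero_le)
    then have "CI {0..<n} = distr (C 0 n ?u) (?P n) (\<lambda>f. restrict f {0..<n})"
      by (simp add: CI_def)
    also have "\<dots> = distr (C 0 n ?u) (C 0 n ?u) (\<lambda>f. f)"
      using space_C[OF u, of n] sets_C[OF u, of n]
      by (intro distr_cong) (auto simp: space_PiM PiE_restrict)
    finally show ?thesis by (simp add: distr_lim)
  qed
  have "(\<integral>\<^sup>+\<omega>. f (map \<omega> [0..<n]) \<partial>run M s\<^sub>0 \<sigma>)
      = (\<integral>\<^sup>+\<omega>. f (map (restrict \<omega> {0..<n}) [0..<n]) \<partial>PF.lim)"
    unfolding run_def by (intro nn_integral_cong arg_cong[where f=f] map_cong) auto
  also have "\<dots> = (\<integral>\<^sup>+\<omega>. f (map \<omega> [0..<n]) \<partial>distr PF.lim (?P n) (\<lambda>\<omega>. restrict \<omega> {0..<n}))"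
  proof -
    have "(\<lambda>\<omega>. restrict \<omega> {0..<n}) \<in> PF.lim \<rightarrow>\<^sub>M ?P n"
      unfolding measurable_cong_sets[OF PF.sets_lim refl] by (rule measurable_restrict_subset) simp
    then show ?thesis
      using meas[of f n] by (subst nn_integral_distr) simp_all
  qed
  finally show ?thesis by (simp add: CI C)
qed

lemma measurable_run:
  fixes M :: "('s::countable, 'a::countable) sp" and f :: "('s, 'a) history \<Rightarrow> 'c"
  shows "(\<lambda>\<omega>. f (map \<omega> [0..<n])) \<in> run M s\<^sub>0 \<sigma> \<rightarrow>\<^sub>M count_space UNIV"
proof -
  have "(\<lambda>\<omega>. map \<omega> [0..<n]) \<in> PiM UNIV (\<lambda>_. count_space (UNIV :: ('s, 'a) step set)) \<rightarrow>\<^sub>M count_space UNIV"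
  proof (induction n)
    case (Suc n)
    have "(\<lambda>\<omega>. map \<omega> [0..<n] @ [\<omega> n]) \<in> PiM UNIV (\<lambda>_. count_space (UNIV :: ('s, 'a) step set)) \<rightarrow>\<^sub>M count_space UNIV"
      by (rule measurable_compose_countable[OF _ Suc])
         (rule measurable_compose[OF measurable_component_singleton], auto)
    then show ?case by simp
  qed simp
  then have "(\<lambda>\<omega>. map \<omega> [0..<n]) \<in> run M s\<^sub>0 \<sigma> \<rightarrow>\<^sub>M count_space UNIV"
    unfolding measurable_cong_sets[OF sets_run refl] .
  then show ?thesis by (rule measurable_compose) simp
qed

section \<open>Episodes and total length\<close>

definition terminations :: "('s, 'a) history \<Rightarrow> nat" where
  "terminations h = length (filter (\<lambda>x. outcome x = None) h)"

lemma terminations_simps [simp]: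
  "terminations [] = 0"
  "terminations (h @ [x]) = terminations h + (if outcome x = None then 1 else 0)"
  by (simp_all add: terminations_def)

lemma terminations_map_mono: "m \<le> n \<Longrightarrow> terminations (map \<omega> [0..<m]) \<le> terminations (map \<omega> [0..<n])"
  by (induction n rule: dec_induct) auto

lemma terminations_map_lessD:
  assumes "m \<le> n" "terminations (map \<omega> [0..<m]) < terminations (map \<omega> [0..<n])"
  shows "\<exists>i\<ge>m. i < n \<and> outcome (\<omega> i) = None"
  using assms
proof (induction n rule: dec_induct)
  case (step n)
  then show ?case
    by (cases "outcome (\<omega> n) = None") (auto intro: less_SucI)
qed simp

lemma terminations_map_const:
  assumes "m \<le> n" "\<And>i. m \<le> i \<Longrightarrow> i < n \<Longrightarrow> outcome (\<omega> i) \<noteq> None"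
  shows "terminations (map \<omega> [0..<n]) = terminations (map \<omega> [0..<m])"
  using assms by (induction n rule: dec_induct) auto

text \<open>The hypothesis is the conclusion of \<open>less_episode_start_iff\<close>, whose own
  induction already needs this consequence for the previous episode.\<close>

lemma terminations_episode_start:
  assumes "\<And>t. t < episode_start \<omega> k \<longleftrightarrow> terminations (map \<omega> [0..<t]) < k"
  shows "terminations (map \<omega> [0..<episode_start \<omega> k]) = k"
proof (rule antisym)
  show "terminations (map \<omega> [0..<episode_start \<omega> k]) \<le> k"
  proof (cases "episode_start \<omega> k")
    case (Suc t)
    then have "terminations (map \<omega> [0..<t]) < k" using assms[of t] by simp
    with Suc show ?thesis by simp
  qed simp
  show "k \<le> terminations (map \<omega> [0..<episode_start \<omega> k])"
    using assms[of "episode_start \<omega> k"] by simp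
qed

text \<open>Makes \<open>episode_start\<close> a stopping time: the first \<open>t\<close> steps
  decide whether episode \<open>k\<close> starts after time \<open>t\<close>. Lengths thereby become
  sums of events visible to \<open>history_pmf\<close>.\<close>

lemma less_episode_start_iff:
  assumes "\<exists>t. k \<le> terminations (map \<omega> [0..<t])"
  shows "t < episode_start \<omega> k \<longleftrightarrow> terminations (map \<omega> [0..<t]) < k"
  using assms
proof (induction k arbitrary: t)
  case (Suc k)
  let ?c = "\<lambda>t. terminations (map \<omega> [0..<t])" and ?e = "episode_start \<omega> k"
  obtain T where T: "Suc k \<le> ?c T" using Suc.prems by blast
  have IH: "t < ?e \<longleftrightarrow> ?c t < k" for t
    using Suc.IH[of t] T Suc_leD by blast
  have e: "?c ?e = k" by (rule terminations_episode_start[OF IH])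
  have "?e \<le> T" using T e terminations_map_mono[of T ?e \<omega>] by linarith
  then obtain i where i: "?e \<le> i" "outcome (\<omega> i) = None"
    using terminations_map_lessD[of ?e T \<omega>] T e by auto
  \<comment> \<open>\<open>j\<close> is the last time of episode \<open>k\<close>: before it the
    count of terminations is still \<open>k\<close>, and at \<open>Suc j\<close> it is
    \<open>Suc k\<close>.\<close>
  define j where "j = end_from \<omega> ?e"
  have j: "?e \<le> j" "outcome (\<omega> j) = None"
    using LeastI[of "\<lambda>i. ?e \<le> i \<and> outcome (\<omega> i) = None" i] i by (auto simp: j_def end_from_def)
  have "?c j = k"
    using terminations_map_const[OF j(1), of \<omega>] e
      not_less_Least[of _ "\<lambda>i. ?e \<le> i \<and> outcome (\<omega> i) = None"]
    by (auto simp: j_def end_from_def)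
  then have "?c (Suc j) = Suc k" using j by simp
  then have "t \<le> j \<longleftrightarrow> ?c t < Suc k"
    using terminations_map_mono[of t j \<omega>] terminations_map_mono[of "Suc j" t \<omega>] \<open>?c j = k\<close>
    by (cases "t \<le> j") auto
  then show ?case by (simp add: j_def less_Suc_eq_le)
qed simp

lemma episode_return_const:
  "episode_return (\<lambda>_ _. 1) \<omega> k = real (card {episode_start \<omega> k..episode_end \<omega> k})"
proof -
  have "step_reward (\<lambda>_ _. 1) x = 1" for x :: "('a, 'b) step" by (cases x) auto
  then show ?thesis by (simp add: episode_return_def)
qed

text \<open>With unit rewards the returns are lengths and telescope; strict growth of
  \<open>episode_start\<close> keeps the subtraction of naturals exact.\<close>

lemma sum_episode_return_const:
  assumes "\<exists>t. K \<le> terminations (map \<omega> [0..<t])"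
  shows "(\<Sum>k<K. episode_return (\<lambda>_ _. 1) \<omega> k) = real (episode_start \<omega> K)"
  using assms
proof (induction K)
  case (Suc k)
  obtain T where T: "Suc k \<le> terminations (map \<omega> [0..<T])" using Suc.prems by blast
  then have ex: "\<exists>t. k \<le> terminations (map \<omega> [0..<t])" using Suc_leD by blast
  have "terminations (map \<omega> [0..<episode_start \<omega> k]) = k"
    by (rule terminations_episode_start) (rule less_episode_start_iff[OF ex])
  then have "episode_start \<omega> k < episode_start \<omega> (Suc k)"
    unfolding less_episode_start_iff[OF Suc.prems] by simp
  then show ?case
    using Suc.IH[OF ex] by (simp add: episode_return_const episode_end_def of_nat_diff)
qed simp

section \<open>Tail-sum formulas for the lengths of episodes\<close>

text \<open>When the episodes end almost surely, this is the probability that the first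
  \<open>K\<close> of them last longer than \<open>t\<close> steps, so its sum over \<open>t\<close>
  is their expected total length.\<close>

definition unfinished ::
    "('s, 'a) sp \<Rightarrow> 's \<Rightarrow> (('s, 'a) history \<Rightarrow> 's \<Rightarrow> 'a pmf) \<Rightarrow> nat \<Rightarrow> nat \<Rightarrow> real" where
  "unfinished M s\<^sub>0 \<sigma> K t = measure_pmf.prob (history_pmf M s\<^sub>0 \<sigma> t) {h. terminations h < K}"

lemma unfinished_nonneg: "0 \<le> unfinished M s\<^sub>0 \<sigma> K t"
  by (simp add: unfinished_def)

context
  fixes M :: "('s::countable, 'a::countable) sp" and s\<^sub>0 :: 's
    and \<sigma> :: "('s, 'a) history \<Rightarrow> 's \<Rightarrow> 'a pmf"
begin

lemma measurable_outcome_run: "(\<lambda>\<omega>. outcome (\<omega> i)) \<in> run M s\<^sub>0 \<sigma> \<rightarrow>\<^sub>M count_space UNIV"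
  using measurable_run[of "\<lambda>h. outcome (last h)" "Suc i" M s\<^sub>0 \<sigma>] by simp

lemma measurable_episode_start: "(\<lambda>\<omega>. episode_start \<omega> k) \<in> run M s\<^sub>0 \<sigma> \<rightarrow>\<^sub>M count_space UNIV"
  and measurable_episode_end: "(\<lambda>\<omega>. episode_end \<omega> k) \<in> run M s\<^sub>0 \<sigma> \<rightarrow>\<^sub>M count_space UNIV"
proof -
  have pred: "Measurable.pred (run M s\<^sub>0 \<sigma>) (\<lambda>\<omega>. n \<le> i \<and> outcome (\<omega> i) = None)" for n i
    using measurable_compose[OF measurable_outcome_run, of "\<lambda>x. n \<le> i \<and> x = None"] by simp
  have e: "(\<lambda>\<omega>. end_from \<omega> n) \<in> run M s\<^sub>0 \<sigma> \<rightarrow>\<^sub>M count_space UNIV" for n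
    unfolding end_from_def by (rule measurable_Least) (rule pred)
  have comp: "(\<lambda>\<omega>. end_from \<omega> (g \<omega>)) \<in> run M s\<^sub>0 \<sigma> \<rightarrow>\<^sub>M count_space UNIV"
    if "g \<in> run M s\<^sub>0 \<sigma> \<rightarrow>\<^sub>M count_space UNIV" for g
    by (rule measurable_compose_countable[OF e that])
  show s: "(\<lambda>\<omega>. episode_start \<omega> k) \<in> run M s\<^sub>0 \<sigma> \<rightarrow>\<^sub>M count_space UNIV"
  proof (induction k)
    case (Suc k)
    show ?case using measurable_compose[OF comp[OF Suc], of Suc] by simp
  qed simp
  show "(\<lambda>\<omega>. episode_end \<omega> k) \<in> run M s\<^sub>0 \<sigma> \<rightarrow>\<^sub>M count_space UNIV"
    unfolding episode_end_def by (rule comp[OF s])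
qed

lemma measurable_episode_return_const:
  "(\<lambda>\<omega>. episode_return (\<lambda>_ _. 1) \<omega> k) \<in> borel_measurable (run M s\<^sub>0 \<sigma>)"
proof -
  have "(\<lambda>\<omega>. real (card {episode_start \<omega> k..i})) \<in> borel_measurable (run M s\<^sub>0 \<sigma>)" for i
    by (rule measurable_compose[OF measurable_episode_start]) simp
  then show ?thesis
    unfolding episode_return_const
    by (rule measurable_compose_countable[OF _ measurable_episode_end])
qed

text \<open>Sum and integral are exchanged, and each summand depends on the first \<open>t\<close>
  steps only. Constant weights give expected lengths, weights \<open>2 t + 1\<close> second
  moments.\<close>

lemma nn_integral_run_weights:
  "(\<integral>\<^sup>+\<omega>. (\<Sum>t. ennreal (w t) * of_bool (terminations (map \<omega> [0..<t]) < K)) \<partial>run M s\<^sub>0 \<sigma>)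
    = (\<Sum>t. ennreal (w t) * ennreal (unfinished M s\<^sub>0 \<sigma> K t))"
proof -
  have meas: "(\<lambda>\<omega>. f (map \<omega> [0..<t])) \<in> borel_measurable (run M s\<^sub>0 \<sigma>)"
    for f :: "('s, 'a) history \<Rightarrow> ennreal" and t
    by (rule measurable_compose[OF measurable_run[of "\<lambda>x. x"]]) simp
  have "(\<integral>\<^sup>+\<omega>. (\<Sum>t. ennreal (w t) * of_bool (terminations (map \<omega> [0..<t]) < K)) \<partial>run M s\<^sub>0 \<sigma>)
      = (\<Sum>t. \<integral>\<^sup>+\<omega>. ennreal (w t) * of_bool (terminations (map \<omega> [0..<t]) < K) \<partial>run M s\<^sub>0 \<sigma>)"
    by (rule nn_integral_suminf) (rule meas)
  also have "\<dots> = (\<Sum>t. \<integral>\<^sup>+h. ennreal (w t) * indicator {h. terminations h < K} h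
      \<partial>history_pmf M s\<^sub>0 \<sigma> t)"
  proof (rule arg_cong[where f=suminf], rule ext)
    fix t
    show "(\<integral>\<^sup>+\<omega>. ennreal (w t) * of_bool (terminations (map \<omega> [0..<t]) < K) \<partial>run M s\<^sub>0 \<sigma>)
        = (\<integral>\<^sup>+h. ennreal (w t) * indicator {h. terminations h < K} h \<partial>history_pmf M s\<^sub>0 \<sigma> t)"
      unfolding nn_integral_run[where f="\<lambda>h. ennreal (w t) * of_bool (terminations h < K)"]
      by (simp add: indicator_def)
  qed
  also have "\<dots> = (\<Sum>t. ennreal (w t) * ennreal (unfinished M s\<^sub>0 \<sigma> K t))"
    by (simp add: nn_integral_cmult_indicator unfinished_def measure_pmf.emeasure_eq_measure)
  finally show ?thesis .
qed

text \<open>A path that never reaches \<open>K\<close> terminations makes the sum of indicators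
  infinite, but the expectation of that sum is finite.\<close>

lemma AE_terminations:
  assumes "summable (unfinished M s\<^sub>0 \<sigma> K)"
  shows "AE \<omega> in run M s\<^sub>0 \<sigma>. \<exists>t. K \<le> terminations (map \<omega> [0..<t])"
proof -
  let ?f = "\<lambda>\<omega>. \<Sum>t. ennreal 1 * of_bool (terminations (map \<omega> [0..<t]) < K)"
  have "(\<Sum>t. ennreal 1 * ennreal (unfinished M s\<^sub>0 \<sigma> K t)) \<noteq> \<infinity>"
    using assms by (simp add: suminf_ennreal2 unfinished_nonneg)
  then have "integral\<^sup>N (run M s\<^sub>0 \<sigma>) ?f \<noteq> \<infinity>"
    using nn_integral_run_weights[of "\<lambda>_. 1" K] by simp
  moreover have "(\<lambda>\<omega>. ennreal 1 * of_bool (terminations (map \<omega> [0..<t]) < K)) \<in> borel_measurable (run M s\<^sub>0 \<sigma>)" for t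
    by (rule measurable_compose[OF measurable_run[of "\<lambda>x. x"]]) simp
  ultimately have "AE \<omega> in run M s\<^sub>0 \<sigma>. ?f \<omega> \<noteq> \<infinity>"
    by (intro nn_integral_PInf_AE borel_measurable_suminf) auto
  then show ?thesis
  proof eventually_elim
    case (elim \<omega>)
    show ?case
    proof (rule ccontr)
      assume "\<not> ?case"
      then have f: "?f \<omega> = (\<Sum>t. 1)" by (simp add: not_le)
      have "of_nat n \<le> ?f \<omega>" for n
        unfolding f using sum_le_suminf[of "\<lambda>_. 1 :: ennreal" "{..<n}"] by simp
      then have "(SUP n. of_nat n) \<le> ?f \<omega>" by (rule SUP_least)
      then show False using elim by (simp add: ennreal_SUP_of_nat_eq_top top_unique)
    qed
  qed
qed

lemma nn_integral_episode_start:
  assumes "summable (unfinished M s\<^sub>0 \<sigma> K)" "\<And>t. 0 \<le> w t"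
  shows "(\<integral>\<^sup>+\<omega>. ennreal (\<Sum>t<episode_start \<omega> K. w t) \<partial>run M s\<^sub>0 \<sigma>)
    = (\<Sum>t. ennreal (w t * unfinished M s\<^sub>0 \<sigma> K t))"
proof -
  have "AE \<omega> in run M s\<^sub>0 \<sigma>. ennreal (\<Sum>t<episode_start \<omega> K. w t)
      = (\<Sum>t. ennreal (w t) * of_bool (terminations (map \<omega> [0..<t]) < K))"
    using AE_terminations[OF assms(1)]
  proof eventually_elim
    case (elim \<omega>)
    show ?case
      by (subst suminf_finite[of "{..<episode_start \<omega> K}"])
         (auto simp: less_episode_start_iff[OF elim, symmetric] assms(2) simp flip: sum_ennreal)
  qed
  then have "(\<integral>\<^sup>+\<omega>. ennreal (\<Sum>t<episode_start \<omega> K. w t) \<partial>run M s\<^sub>0 \<sigma>)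
      = (\<integral>\<^sup>+\<omega>. (\<Sum>t. ennreal (w t) * of_bool (terminations (map \<omega> [0..<t]) < K)) \<partial>run M s\<^sub>0 \<sigma>)"
    by (rule nn_integral_cong_AE)
  then show ?thesis
    by (simp add: nn_integral_run_weights ennreal_mult unfinished_nonneg assms(2))
qed

lemma has_bochner_integral_returns:
  assumes "summable (unfinished M s\<^sub>0 \<sigma> K)"
  shows "has_bochner_integral (run M s\<^sub>0 \<sigma>) (\<lambda>\<omega>. \<Sum>k<K. episode_return (\<lambda>_ _. 1) \<omega> k)
    (\<Sum>t. unfinished M s\<^sub>0 \<sigma> K t)"
proof (rule has_bochner_integral_nn_integral)
  show "(\<lambda>\<omega>. \<Sum>k<K. episode_return (\<lambda>_ _. 1) \<omega> k) \<in> borel_measurable (run M s\<^sub>0 \<sigma>)"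
    using measurable_episode_return_const by (rule borel_measurable_sum)
  show "AE \<omega> in run M s\<^sub>0 \<sigma>. 0 \<le> (\<Sum>k<K. episode_return (\<lambda>_ _. 1) \<omega> k)"
    by (simp add: episode_return_const sum_nonneg)
  show "0 \<le> (\<Sum>t. unfinished M s\<^sub>0 \<sigma> K t)"
    using assms unfinished_nonneg by (intro suminf_nonneg)
  have "(\<integral>\<^sup>+\<omega>. ennreal (\<Sum>k<K. episode_return (\<lambda>_ _. 1) \<omega> k) \<partial>run M s\<^sub>0 \<sigma>)
      = (\<integral>\<^sup>+\<omega>. ennreal (\<Sum>t<episode_start \<omega> K. 1) \<partial>run M s\<^sub>0 \<sigma>)"
    by (rule nn_integral_cong_AE, rule AE_mp[OF AE_terminations[OF assms]])
       (simp add: sum_episode_return_const)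
  also have "\<dots> = ennreal (\<Sum>t. unfinished M s\<^sub>0 \<sigma> K t)"
    using nn_integral_episode_start[OF assms, of "\<lambda>_. 1"]
    by (simp add: suminf_ennreal2 assms unfinished_nonneg)
  finally show "(\<integral>\<^sup>+\<omega>. ennreal (\<Sum>k<K. episode_return (\<lambda>_ _. 1) \<omega> k) \<partial>run M s\<^sub>0 \<sigma>)
      = ennreal (\<Sum>t. unfinished M s\<^sub>0 \<sigma> K t)" .
qed

text \<open>Summation by tails, using that the first \<open>n\<close> odd numbers add up to
  \<open>n\<^sup>2\<close>.\<close>

lemma nn_integral_return_sq:
  assumes "summable (unfinished M s\<^sub>0 \<sigma> 1)"
  shows "(\<integral>\<^sup>+\<omega>. ennreal ((episode_return (\<lambda>_ _. 1) \<omega> 0)\<^sup>2) \<partial>run M s\<^sub>0 \<sigma>)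
    = (\<Sum>t. ennreal ((2 * real t + 1) * unfinished M s\<^sub>0 \<sigma> 1 t))"
proof -
  have sq: "(\<Sum>t<n. 2 * real t + 1) = (real n)\<^sup>2" for n
    by (induction n) (auto simp: power2_eq_square algebra_simps)
  have "(\<integral>\<^sup>+\<omega>. ennreal ((episode_return (\<lambda>_ _. 1) \<omega> 0)\<^sup>2) \<partial>run M s\<^sub>0 \<sigma>)
      = (\<integral>\<^sup>+\<omega>. ennreal (\<Sum>t<episode_start \<omega> 1. 2 * real t + 1) \<partial>run M s\<^sub>0 \<sigma>)"
  proof (rule nn_integral_cong_AE, rule AE_mp[OF AE_terminations[OF assms]], rule AE_I2, rule impI)
    fix \<omega> :: "nat \<Rightarrow> ('s, 'a) step" assume "\<exists>t. 1 \<le> terminations (map \<omega> [0..<t])"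
    from sum_episode_return_const[OF this]
    show "ennreal ((episode_return (\<lambda>_ _. 1) \<omega> 0)\<^sup>2)
        = ennreal (\<Sum>t<episode_start \<omega> 1. 2 * real t + 1)"
      unfolding sq by simp
  qed
  then show ?thesis
    using nn_integral_episode_start[OF assms, of "\<lambda>t. 2 * real t + 1"] by simp
qed

end

lemma has_bochner_integral_regret:
  fixes M :: "('s::countable, 'a::countable) sp"
  assumes "reward M = (\<lambda>_ _. 1)" "summable (unfinished M s\<^sub>0 \<sigma> K)"
  shows "has_bochner_integral (run M s\<^sub>0 \<sigma>) (regret M K)
    (real K * optimal_value M (init M) - (\<Sum>t. unfinished M s\<^sub>0 \<sigma> K t))"
proof -
  interpret prob_space "run M s\<^sub>0 \<sigma>" by (rule prob_space_run)
  have "has_bochner_integral (run M s\<^sub>0 \<sigma>) (\<lambda>_. real K * optimal_value M (init M))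
      (real K * optimal_value M (init M))"
    by (simp add: has_bochner_integral_iff prob_space)
  from has_bochner_integral_diff[OF this has_bochner_integral_returns[OF assms(2)]]
  show ?thesis
    by (simp add: regret_def[abs_def] assms(1) sum_subtractf)
qed

section \<open>Finite-horizon expectations\<close>

declare history_pmf.simps(2) [simp del]

section \<open>Instances whose actions control only the probability of ending the episode\<close>

definition exit_or_jump :: "nat \<Rightarrow> real \<Rightarrow> nat option pmf" where
  "exit_or_jump S p = bind_pmf (bernoulli_pmf p)
     (\<lambda>b. if b then return_pmf None else map_pmf Some (pmf_of_set {..<S}))"

definition bandit_sp :: "nat \<Rightarrow> nat \<Rightarrow> (nat \<Rightarrow> nat \<Rightarrow> real) \<Rightarrow> (nat, nat) sp" where
  "bandit_sp S A p = \<lparr>states = {..<S}, actions = {..<A}, init = 0,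
     kernel = (\<lambda>s a. exit_or_jump S (p s a)), reward = (\<lambda>_ _. 1)\<rparr>"

lemma bandit_sp_simps [simp]:
  "states (bandit_sp S A p) = {..<S}" "actions (bandit_sp S A p) = {..<A}"
  "init (bandit_sp S A p) = 0" "kernel (bandit_sp S A p) s a = exit_or_jump S (p s a)"
  "reward (bandit_sp S A p) = (\<lambda>_ _. 1)"
  by (simp_all add: bandit_sp_def)

lemma set_pmf_exit_or_jump:
  assumes "0 < S" shows "set_pmf (exit_or_jump S p) \<subseteq> insert None (Some ` {..<S})"
proof -
  have "set_pmf (pmf_of_set {..<S}) = {..<S}" using assms by (intro set_pmf_of_set) auto
  then show ?thesis by (auto simp: exit_or_jump_def split: if_splits)
qed

lemma expectation_exit_or_jump:
  fixes f :: "nat option \<Rightarrow> real"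
  assumes "0 < S" "0 \<le> p" "p \<le> 1"
  shows "measure_pmf.expectation (exit_or_jump S p) f
    = p * f None + (1 - p) * ((\<Sum>s<S. f (Some s)) / real S)"
proof -
  have S: "set_pmf (pmf_of_set {..<S}) = {..<S}" using assms by (intro set_pmf_of_set) auto
  have "measure_pmf.expectation (exit_or_jump S p) f
      = (\<Sum>b\<in>UNIV. pmf (bernoulli_pmf p) b *\<^sub>R measure_pmf.expectation
          (if b then return_pmf None else map_pmf Some (pmf_of_set {..<S})) f)"
    unfolding exit_or_jump_def using S by (intro pmf_expectation_bind) auto
  also have "\<dots> = p * f None + (1 - p) * measure_pmf.expectation (pmf_of_set {..<S}) (\<lambda>s. f (Some s))"
    using assms by (simp add: UNIV_bool)
  also have "measure_pmf.expectation (pmf_of_set {..<S}) (\<lambda>s. f (Some s)) = (\<Sum>s<S. f (Some s)) / real S"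
    using assms by (subst integral_pmf_of_set) auto
  finally show ?thesis .
qed

text \<open>Strict bounds at all arguments, even outside the state and action sets, keep likelihood
  ratios positive on arbitrary histories.\<close>

definition exit_probs :: "(nat \<Rightarrow> nat \<Rightarrow> real) \<Rightarrow> bool" where
  "exit_probs p \<longleftrightarrow> (\<forall>s a. 0 < p s a \<and> p s a < 1)"

lemma exit_probsD: "exit_probs p \<Longrightarrow> 0 < p s a" "exit_probs p \<Longrightarrow> p s a < 1"
  by (auto simp: exit_probs_def)

text \<open>Starts and resets in the initial state do not count as arrivals here, because only the
  target of a jump is drawn independently of everything else.\<close>

definition jumped :: "nat \<Rightarrow> (nat, nat) history \<Rightarrow> real" where
  "jumped s h = of_bool (h \<noteq> [] \<and> outcome (last h) = Some s)"

lemma jumped_snoc [simp]: "jumped s (h @ [x]) = of_bool (outcome x = Some s)"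
  by (simp add: jumped_def)

lemma jumped_bounds: "0 \<le> jumped s h" "jumped s h \<le> 1"
  by (simp_all add: jumped_def)

lemma current_state_snoc [simp]:
  "current_state s\<^sub>0 (h @ [x]) = (case outcome x of None \<Rightarrow> s\<^sub>0 | Some s \<Rightarrow> s)"
  by (simp add: current_state_def)

lemma jumped_current: "jumped s h \<noteq> 0 \<Longrightarrow> current_state s\<^sub>0 h = s"
  by (auto simp: jumped_def current_state_def)

lemma terminations_le_length: "terminations h \<le> length h"
  by (simp add: terminations_def)

text \<open>The choice of action and the uniform target have the same law under both kernels, so
  their factors cancel; the ratio sees \<open>s'\<close> only through whether the episode
  ends.\<close>

definition likelihood_step ::
    "(nat \<Rightarrow> nat \<Rightarrow> real) \<Rightarrow> (nat \<Rightarrow> nat \<Rightarrow> real) \<Rightarrow> (nat, nat) step \<Rightarrow> real" where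
  "likelihood_step p q x = (case x of (s, a, s') \<Rightarrow>
     if s' = None then p s a / q s a else (1 - p s a) / (1 - q s a))"

definition likelihood ::
    "(nat \<Rightarrow> nat \<Rightarrow> real) \<Rightarrow> (nat \<Rightarrow> nat \<Rightarrow> real) \<Rightarrow> (nat, nat) history \<Rightarrow> real" where
  "likelihood p q h = prod_list (map (likelihood_step p q) h)"

lemma likelihood_simps [simp]:
  "likelihood p q [] = 1" "likelihood p q (h @ [x]) = likelihood p q h * likelihood_step p q x"
  by (simp_all add: likelihood_def)

lemma likelihood_step_pos: "exit_probs p \<Longrightarrow> exit_probs q \<Longrightarrow> 0 < likelihood_step p q x"
  by (cases x) (auto simp: likelihood_step_def exit_probs_def)

lemma likelihood_pos: "exit_probs p \<Longrightarrow> exit_probs q \<Longrightarrow> 0 < likelihood p q h"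
  by (induction h rule: rev_induct) (auto intro: mult_pos_pos likelihood_step_pos)

text \<open>The start is a parameter because properness and optimality are tested from every state;
  a deterministic policy enters as a \<open>\<sigma>\<close> of point masses.\<close>

locale bandit_learner =
  fixes S A :: nat and s\<^sub>0 :: nat and \<sigma> :: "(nat, nat) history \<Rightarrow> nat \<Rightarrow> nat pmf"
  assumes s0: "s\<^sub>0 < S" and actions: "\<And>h s. s < S \<Longrightarrow> set_pmf (\<sigma> h s) \<subseteq> {..<A}"
begin

lemma S_pos: "0 < S" using s0 by simp

abbreviation cur :: "(nat, nat) history \<Rightarrow> nat" where
  "cur \<equiv> current_state s\<^sub>0"

abbreviation hist :: "(nat \<Rightarrow> nat \<Rightarrow> real) \<Rightarrow> nat \<Rightarrow> (nat, nat) history pmf" where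
  "hist p \<equiv> history_pmf (bandit_sp S A p) s\<^sub>0 \<sigma>"

abbreviation E :: "(nat \<Rightarrow> nat \<Rightarrow> real) \<Rightarrow> nat \<Rightarrow> ((nat, nat) history \<Rightarrow> real) \<Rightarrow> real" where
  "E p n \<equiv> measure_pmf.expectation (hist p n)"

text \<open>The conditional expectation of \<open>f\<close> one step later given \<open>h\<close>;
  \<open>E_Suc\<close> is the tower property for it.\<close>

definition step :: "(nat \<Rightarrow> nat \<Rightarrow> real) \<Rightarrow> ((nat, nat) history \<Rightarrow> real) \<Rightarrow> (nat, nat) history \<Rightarrow> real" where
  "step p f h = (\<Sum>a<A. pmf (\<sigma> h (cur h)) a * (p (cur h) a * f (h @ [(cur h, a, None)])
     + (1 - p (cur h) a) * ((\<Sum>s<S. f (h @ [(cur h, a, Some s)])) / real S)))"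

lemma finite_actions: "s < S \<Longrightarrow> finite (set_pmf (\<sigma> h s))"
  by (rule finite_subset[OF actions]) simp_all

lemma sum_actions: "s < S \<Longrightarrow> (\<Sum>a<A. pmf (\<sigma> h s) a) = 1"
  by (rule sum_pmf_eq_1) (simp_all add: actions)

lemma sum_actions_le: "s < S \<Longrightarrow> (\<Sum>a<A. pmf (\<sigma> h s) a * c) = c"
  by (simp add: sum_actions flip: sum_distrib_right)

lemma cur_hist: "h \<in> set_pmf (hist p n) \<Longrightarrow> cur h < S"
proof (induction n arbitrary: h)
  case 0 then show ?case by (simp add: current_state_def s0)
next
  case (Suc n)
  then obtain h' a s' where h': "h' \<in> set_pmf (hist p n)" "h = h' @ [(cur h', a, s')]"
      "s' \<in> set_pmf (exit_or_jump S (p (cur h') a))"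
    by (auto simp: history_pmf.simps(2) next_step_def Let_def)
  then show ?case
    using set_pmf_exit_or_jump[OF S_pos, of "p (cur h') a"] s0 by (auto split: option.split)
qed

lemma finite_next_step:
  assumes "cur h < S" shows "finite (set_pmf (next_step (bandit_sp S A p) s\<^sub>0 \<sigma> h))"
proof -
  have "finite (set_pmf (exit_or_jump S q))" for q
    using set_pmf_exit_or_jump[OF S_pos] by (rule finite_subset) simp
  then show ?thesis using assms by (auto simp: next_step_def Let_def finite_actions)
qed

lemma finite_hist [simp]: "finite (set_pmf (hist p n))"
  by (induction n) (auto simp: history_pmf.simps(2) intro!: finite_next_step cur_hist)

lemma integrable_hist [simp]: "integrable (measure_pmf (hist p n)) (f :: _ \<Rightarrow> real)"
  by (rule integrable_measure_pmf_finite) simp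

lemma E_cong: "(\<And>h. cur h < S \<Longrightarrow> length h = n \<Longrightarrow> f h = g h) \<Longrightarrow> E p n f = E p n g"
  by (intro integral_cong_AE) (auto simp: AE_measure_pmf_iff cur_hist length_history_pmf)

lemma E_mono: "(\<And>h. cur h < S \<Longrightarrow> length h = n \<Longrightarrow> f h \<le> g h) \<Longrightarrow> E p n f \<le> E p n g"
  by (intro integral_mono_AE) (auto simp: AE_measure_pmf_iff cur_hist length_history_pmf)

lemma E_0: "E p 0 f = f []"
  by simp

lemma expectation_next_step:
  assumes "exit_probs p" "cur h < S"
  shows "measure_pmf.expectation (next_step (bandit_sp S A p) s\<^sub>0 \<sigma> h) (\<lambda>x. f (h @ [x])) = step p f h"
proof -
  have fin: "finite (set_pmf (exit_or_jump S q))" for q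
    using set_pmf_exit_or_jump[OF S_pos] by (rule finite_subset) simp
  have "measure_pmf.expectation (next_step (bandit_sp S A p) s\<^sub>0 \<sigma> h) (\<lambda>x. f (h @ [x]))
     = (\<Sum>a<A. pmf (\<sigma> h (cur h)) a *\<^sub>R measure_pmf.expectation
         (map_pmf (\<lambda>s'. (cur h, a, s')) (exit_or_jump S (p (cur h) a))) (\<lambda>x. f (h @ [x])))"
    unfolding next_step_def Let_def bandit_sp_simps
    using actions[OF assms(2)] by (intro pmf_expectation_bind) (auto simp: fin)
  also have "\<dots> = step p f h"
    using exit_probsD[OF assms(1)] S_pos
    by (simp add: step_def expectation_exit_or_jump less_imp_le)
  finally show ?thesis .
qed

lemma E_Suc:
  assumes "exit_probs p"
  shows "E p (Suc n) f = E p n (step p f)"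
proof -
  have "E p (Suc n) f = (\<Sum>h\<in>set_pmf (hist p n). pmf (hist p n) h *\<^sub>R measure_pmf.expectation
      (map_pmf (\<lambda>x. h @ [x]) (next_step (bandit_sp S A p) s\<^sub>0 \<sigma> h)) f)"
    unfolding history_pmf.simps
    by (intro pmf_expectation_bind) (auto intro!: finite_next_step cur_hist)
  also have "\<dots> = (\<Sum>h\<in>set_pmf (hist p n). pmf (hist p n) h *\<^sub>R step p f h)"
    by (intro sum.cong refl) (simp add: expectation_next_step[OF assms] cur_hist)
  also have "\<dots> = E p n (step p f)"
    by (rule integral_measure_pmf[symmetric]) auto
  finally show ?thesis .
qed

lemma step_mono:
  assumes "exit_probs p"
    "\<And>a. p (cur h) a * f (h @ [(cur h, a, None)])
       + (1 - p (cur h) a) * ((\<Sum>s<S. f (h @ [(cur h, a, Some s)])) / real S) \<le> g a"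
  shows "step p f h \<le> (\<Sum>a<A. pmf (\<sigma> h (cur h)) a * g a)"
  unfolding step_def by (intro sum_mono mult_left_mono assms) simp

lemma step_outcome:
  assumes "\<And>a s. f (h @ [(cur h, a, Some s)]) = g a"
  shows "step p f h = (\<Sum>a<A. pmf (\<sigma> h (cur h)) a
    * (p (cur h) a * f (h @ [(cur h, a, None)]) + (1 - p (cur h) a) * g a))"
  using S_pos by (simp add: step_def assms)

text \<open>\<open>jumped s\<close> selects one of \<open>S\<close> equally likely targets, which is
  the origin of the weight \<open>1 / S\<close>.\<close>

lemma step_jumped:
  assumes "s < S"
  shows "step p (\<lambda>h. jumped s h * f h) h = (\<Sum>a<A. pmf (\<sigma> h (cur h)) a
    * ((1 - p (cur h) a) * (f (h @ [(cur h, a, Some s)]) / real S)))"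
proof -
  have "(\<Sum>s'<S. (of_bool (s' = s) :: real) * f (h @ [(cur h, a, Some s')])) = f (h @ [(cur h, a, Some s)])" for a
    using assms by (subst sum.remove[of _ s]) (auto intro!: sum.neutral)
  then show ?thesis by (simp add: step_def)
qed

section \<open>Terminations, survival and visits at finite horizon\<close>

lemma unfinished_eq: "unfinished (bandit_sp S A p) s\<^sub>0 \<sigma> K t = E p t (\<lambda>h. of_bool (terminations h < K))"
proof -
  have "unfinished (bandit_sp S A p) s\<^sub>0 \<sigma> K t = E p t (indicator {h. terminations h < K})"
    by (simp add: unfinished_def)
  then show ?thesis by (simp only: indicator_def[abs_def] mem_Collect_eq)
qed

text \<open>Doob's compensator: while the truncated count is below \<open>K\<close>, its conditional
  expected increment is the current exit probability averaged over actions.\<close>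

lemma E_terminations:
  assumes "exit_probs p"
  shows "E p n (\<lambda>h. real (min (terminations h) K)) = (\<Sum>t<n. E p t (\<lambda>h. of_bool (terminations h < K)
    * (\<Sum>a<A. pmf (\<sigma> h (cur h)) a * p (cur h) a)))"
proof (induction n)
  case (Suc n)
  let ?r = "\<lambda>h. \<Sum>a<A. pmf (\<sigma> h (cur h)) a * p (cur h) a"
  have "step p (\<lambda>h. real (min (terminations h) K)) h
      = real (min (terminations h) K) + of_bool (terminations h < K) * ?r h" if "cur h < S" for h
  proof -
    let ?m = "real (min (terminations h) K)"
    have "step p (\<lambda>h. real (min (terminations h) K)) h
        = (\<Sum>a<A. pmf (\<sigma> h (cur h)) a * (p (cur h) a * real (min (Suc (terminations h)) K) + (1 - p (cur h) a) * ?m))"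
      by (subst step_outcome) auto
    also have "\<dots> = (\<Sum>a<A. pmf (\<sigma> h (cur h)) a * ?m
        + of_bool (terminations h < K) * (pmf (\<sigma> h (cur h)) a * p (cur h) a))"
      by (intro sum.cong refl) (auto simp: algebra_simps min_def)
    also have "\<dots> = ?m + of_bool (terminations h < K) * ?r h"
      using sum_actions_le[OF that, of h ?m] by (simp add: sum.distrib sum_distrib_left)
    finally show ?thesis .
  qed
  then have "E p (Suc n) (\<lambda>h. real (min (terminations h) K))
      = E p n (\<lambda>h. real (min (terminations h) K) + of_bool (terminations h < K) * ?r h)"
    unfolding E_Suc[OF assms] by (intro E_cong)
  then show ?case by (simp add: Suc.IH)
qed simp

lemma survival_le:
  assumes "exit_probs p" "\<And>s a. q \<le> p s a"
  shows "E p n (\<lambda>h. of_bool (terminations h < 1)) \<le> (1 - q) ^ n"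
proof (induction n)
  case (Suc n)
  have "step p (\<lambda>h. of_bool (terminations h < 1)) h \<le> (1 - q) * of_bool (terminations h < 1)"
    if "cur h < S" for h
  proof -
    have "step p (\<lambda>h. of_bool (terminations h < 1)) h
        \<le> (\<Sum>a<A. pmf (\<sigma> h (cur h)) a * ((1 - q) * of_bool (terminations h < 1)))"
      using assms(2) S_pos by (intro step_mono[OF assms(1)]) auto
    then show ?thesis by (simp only: sum_actions_le[OF that])
  qed
  then have "E p (Suc n) (\<lambda>h. of_bool (terminations h < 1)) \<le> E p n (\<lambda>h. (1 - q) * of_bool (terminations h < 1))"
    unfolding E_Suc[OF assms(1)] by (intro E_mono)
  also have "\<dots> = (1 - q) * E p n (\<lambda>h. of_bool (terminations h < 1))" by simp
  also have "\<dots> \<le> (1 - q) * (1 - q) ^ n"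
    using Suc.IH assms(2)[of 0 0] exit_probsD(2)[OF assms(1), of 0 0]
    by (intro mult_left_mono) auto
  finally show ?case by simp
qed simp

lemma E_terminations_le:
  assumes "exit_probs p" "\<And>s a. p s a \<le> q"
  shows "E p n (\<lambda>h. real (terminations h)) \<le> real n * q"
proof -
  \<comment> \<open>At most \<open>n\<close> terminations fit into \<open>n\<close> steps, so
    truncation at \<open>n\<close> changes nothing and \<open>E_terminations\<close>
    applies.\<close>
  have "E p n (\<lambda>h. real (terminations h)) = E p n (\<lambda>h. real (min (terminations h) n))"
    by (intro E_cong) (use terminations_le_length in \<open>auto simp: min_def\<close>)
  also have "\<dots> = (\<Sum>t<n. E p t (\<lambda>h. of_bool (terminations h < n)
    * (\<Sum>a<A. pmf (\<sigma> h (cur h)) a * p (cur h) a)))"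
    by (rule E_terminations[OF assms(1)])
  also have "\<dots> \<le> (\<Sum>t<n. q)"
  proof (intro sum_mono)
    fix t
    have q: "0 \<le> q" using exit_probsD(1)[OF assms(1), of 0 0] assms(2)[of 0 0] by simp
    have "E p t (\<lambda>h. of_bool (terminations h < n) * (\<Sum>a<A. pmf (\<sigma> h (cur h)) a * p (cur h) a)) \<le> E p t (\<lambda>_. q)"
    proof (rule E_mono)
      fix h assume h: "cur h < S"
      have "(\<Sum>a<A. pmf (\<sigma> h (cur h)) a * p (cur h) a) \<le> (\<Sum>a<A. pmf (\<sigma> h (cur h)) a * q)"
        by (intro sum_mono mult_left_mono assms) simp
      then show "of_bool (terminations h < n) * (\<Sum>a<A. pmf (\<sigma> h (cur h)) a * p (cur h) a) \<le> q"
        using q by (simp add: sum_actions_le[OF h])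
    qed
    then show "E p t (\<lambda>h. of_bool (terminations h < n) * (\<Sum>a<A. pmf (\<sigma> h (cur h)) a * p (cur h) a)) \<le> q"
      by simp
  qed
  finally show ?thesis by simp
qed

lemma finished_le:
  assumes "exit_probs p" "\<And>s a. p s a \<le> q" "0 < K"
  shows "E p n (\<lambda>h. of_bool (K \<le> terminations h)) \<le> real n * q / real K"
proof -
  have "E p n (\<lambda>h. of_bool (K \<le> terminations h)) \<le> E p n (\<lambda>h. real (terminations h) / real K)"
    using assms(3) by (intro E_mono) auto
  also have "\<dots> = E p n (\<lambda>h. real (terminations h)) / real K" by simp
  also have "\<dots> \<le> real n * q / real K"
    using E_terminations_le[OF assms(1,2)] by (intro divide_right_mono) auto
  finally show ?thesis .
qed

text \<open>A visit to \<open>s\<close> comes from a jump or, in the initial state only, from a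
  start or reset, bounded crudely by 1. Summed over all states the crude term merely doubles the
  total.\<close>

lemma E_current_state_le:
  assumes "exit_probs p" "s < S"
  shows "E p n (\<lambda>h. of_bool (cur h = s)) \<le> 1 / real S + of_bool (s = s\<^sub>0)"
proof (cases n)
  case 0
  show ?thesis unfolding 0 E_0 by (simp add: current_state_def)
next
  case (Suc m)
  have "step p (\<lambda>h. of_bool (cur h = s)) h \<le> 1 / real S + of_bool (s = s\<^sub>0)" if h: "cur h < S" for h
  proof -
    have "step p (\<lambda>h. of_bool (cur h = s)) h
        \<le> (\<Sum>a<A. pmf (\<sigma> h (cur h)) a * (1 / real S + of_bool (s = s\<^sub>0)))"
    proof (rule step_mono[OF assms(1)])
      fix a
      have "(\<Sum>s'<S. of_bool (cur (h @ [(cur h, a, Some s')]) = s)) = (1::real)"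
        using assms(2) by (subst sum.remove[of _ s]) (auto intro!: sum.neutral)
      moreover have "p (cur h) a * of_bool (s\<^sub>0 = s) \<le> of_bool (s\<^sub>0 = s)"
        "(1 - p (cur h) a) * (1 / real S) \<le> 1 / real S"
        using exit_probsD[OF assms(1), of "cur h" a] by (auto intro!: divide_right_mono mult_left_le_one_le)
      ultimately show "p (cur h) a * of_bool (cur (h @ [(cur h, a, None)]) = s)
          + (1 - p (cur h) a) * ((\<Sum>s'<S. of_bool (cur (h @ [(cur h, a, Some s')]) = s)) / real S)
          \<le> 1 / real S + of_bool (s = s\<^sub>0)"
        by (auto simp: eq_commute[of s])
    qed
    then show ?thesis by (simp only: sum_actions_le[OF h])
  qed
  then have "E p (Suc m) (\<lambda>h. of_bool (cur h = s)) \<le> E p m (\<lambda>_. 1 / real S + of_bool (s = s\<^sub>0))"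
    unfolding E_Suc[OF assms(1)] by (intro E_mono)
  then show ?thesis by (simp add: Suc)
qed

lemma E_jumped_bounds:
  assumes "exit_probs p" "s < S" "\<And>s a. q \<le> p s a" "\<And>s a. p s a \<le> q'"
  shows "E p (Suc n) (jumped s) \<le> (1 - q) / real S" "(1 - q') / real S \<le> E p (Suc n) (jumped s)"
proof -
  have st: "step p (jumped s) h = (\<Sum>a<A. pmf (\<sigma> h (cur h)) a * ((1 - p (cur h) a) * (1 / real S)))" for h
    using step_jumped[OF assms(2), of p "\<lambda>_. 1"] by simp
  have "step p (jumped s) h \<le> (1 - q) / real S" "(1 - q') / real S \<le> step p (jumped s) h"
    if h: "cur h < S" for h
  proof -
    have "step p (jumped s) h \<le> (\<Sum>a<A. pmf (\<sigma> h (cur h)) a * ((1 - q) * (1 / real S)))"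
      unfolding st by (intro sum_mono mult_left_mono mult_right_mono) (auto simp: assms)
    then show "step p (jumped s) h \<le> (1 - q) / real S" by (simp only: sum_actions_le[OF h]) simp
    have "step p (jumped s) h \<ge> (\<Sum>a<A. pmf (\<sigma> h (cur h)) a * ((1 - q') * (1 / real S)))"
      unfolding st by (intro sum_mono mult_left_mono mult_right_mono) (auto simp: assms)
    then show "(1 - q') / real S \<le> step p (jumped s) h" by (simp only: sum_actions_le[OF h]) simp
  qed
  then have "E p n (step p (jumped s)) \<le> E p n (\<lambda>_. (1 - q) / real S)"
    "E p n (\<lambda>_. (1 - q') / real S) \<le> E p n (step p (jumped s))"
    by (intro E_mono; blast)+
  then show "E p (Suc n) (jumped s) \<le> (1 - q) / real S" "(1 - q') / real S \<le> E p (Suc n) (jumped s)"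
    unfolding E_Suc[OF assms(1)] by simp_all
qed

section \<open>Change of measure and information\<close>

lemma change_of_measure:
  assumes "exit_probs p" "exit_probs q"
  shows "E p n f = E q n (\<lambda>h. likelihood p q h * f h)"
proof (induction n arbitrary: f)
  case (Suc n)
  have "likelihood p q h * step p f h = step q (\<lambda>h. likelihood p q h * f h) h" for h
  proof -
    define r r' where "r s a = p s a / q s a" and "r' s a = (1 - p s a) / (1 - q s a)" for s a
    have lik: "likelihood_step p q (s, a, None) = r s a" "likelihood_step p q (s, a, Some s') = r' s a" for s a s'
      by (simp_all add: likelihood_step_def r_def r'_def)
    have r: "q s a * r s a = p s a" "(1 - q s a) * r' s a = 1 - p s a" for s a
      using exit_probsD[OF assms(2), of s a] by (simp_all add: r_def r'_def)
    \<comment> \<open>\<open>R\<close> and \<open>R'\<close> stand for the one-step ratios;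
      multiplying the exit and jump probabilities under \<open>q\<close> by them restores those
      under \<open>p\<close>.\<close>
    have "L * (c * (P * x + P' * (y / n))) = c * (Q * (L * (R * x)) + Q' * (L * (R' * y) / n))"
      if "Q * R = P" "Q' * R' = P'" for L c x y n P P' Q Q' R R' :: real
      by (simp add: algebra_simps flip: that)
    note eq = this[OF r]
    show ?thesis
      unfolding step_def sum_distrib_left[of "likelihood p q h"] eq
      by (intro sum.cong refl) (simp add: lik mult.assoc flip: sum_distrib_left)
  qed
  then show ?case
    by (simp add: E_Suc[OF assms(1)] E_Suc[OF assms(2)] Suc.IH)
qed simp

text \<open>Per step, Kullback-Leibler divergence is bounded by \<open>\<chi>\<^sup>2\<close>-divergence through \<open>- ln x \<le> 1 / x - 1\<close>.\<close>

lemma E_neg_ln_likelihood_le: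
  assumes "exit_probs p" "exit_probs q"
  shows "E q n (\<lambda>h. - ln (likelihood p q h)) \<le> (\<Sum>t<n. E q t (\<lambda>h. \<Sum>a<A. pmf (\<sigma> h (cur h)) a
    * ((q (cur h) a - p (cur h) a)\<^sup>2 / (p (cur h) a * (1 - p (cur h) a)))))"
proof (induction n)
  case (Suc n)
  let ?D = "\<lambda>h a. (q (cur h) a - p (cur h) a)\<^sup>2 / (p (cur h) a * (1 - p (cur h) a))"
  \<comment> \<open>Chain rule: the logarithm is additive over steps, so only the contribution of
    the last step must be bounded.\<close>
  have ln: "- ln (likelihood p q (h @ [x])) = - ln (likelihood p q h) - ln (likelihood_step p q x)" for h x
    using likelihood_pos[OF assms, of h] likelihood_step_pos[OF assms, of x] by (simp add: ln_mult)
  have "step q (\<lambda>h. - ln (likelihood p q h)) h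
      \<le> - ln (likelihood p q h) + (\<Sum>a<A. pmf (\<sigma> h (cur h)) a * ?D h a)" if h: "cur h < S" for h
  proof -
    have "step q (\<lambda>h. - ln (likelihood p q h)) h
        \<le> (\<Sum>a<A. pmf (\<sigma> h (cur h)) a * (- ln (likelihood p q h) + ?D h a))"
    proof (rule step_mono[OF assms(2)])
      fix a
      define P Q where "P = p (cur h) a" and "Q = q (cur h) a"
      have PQ: "0 < P" "P < 1" "0 < Q" "Q < 1"
        using assms by (auto simp: P_def Q_def exit_probs_def)
      have neg_ln: "- ln x \<le> 1 / x - 1" if "0 < x" for x :: real
        using ln_le_minus_one[of "1 / x"] that by (simp add: ln_div)
      have "Q * (- ln (P / Q)) + (1 - Q) * (- ln ((1 - P) / (1 - Q)))
          \<le> Q * (1 / (P / Q) - 1) + (1 - Q) * (1 / ((1 - P) / (1 - Q)) - 1)"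
        using PQ by (intro add_mono mult_left_mono neg_ln) auto
      also have "\<dots> = (Q - P)\<^sup>2 / (P * (1 - P))"
        using PQ by (simp add: field_simps power2_eq_square)
      finally have "Q * (- ln (P / Q)) + (1 - Q) * (- ln ((1 - P) / (1 - Q))) \<le> (Q - P)\<^sup>2 / (P * (1 - P))" .
      moreover have "Q * (L - x) + (1 - Q) * (real S * (L - y) / real S)
          = L + (Q * (- x) + (1 - Q) * (- y))" for L x y
        using S_pos by (simp add: field_simps)
      ultimately show "q (cur h) a * - ln (likelihood p q (h @ [(cur h, a, None)]))
          + (1 - q (cur h) a) * ((\<Sum>s<S. - ln (likelihood p q (h @ [(cur h, a, Some s)]))) / real S)
          \<le> - ln (likelihood p q h) + ?D h a"
        unfolding ln by (simp add: likelihood_step_def flip: P_def Q_def)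
    qed
    also have "\<dots> = - ln (likelihood p q h) + (\<Sum>a<A. pmf (\<sigma> h (cur h)) a * ?D h a)"
      by (simp only: distrib_left sum.distrib sum_actions_le[OF h])
    finally show ?thesis .
  qed
  then have "E q (Suc n) (\<lambda>h. - ln (likelihood p q h))
      \<le> E q n (\<lambda>h. - ln (likelihood p q h) + (\<Sum>a<A. pmf (\<sigma> h (cur h)) a * ?D h a))"
    unfolding E_Suc[OF assms(2)] by (intro E_mono)
  also have "\<dots> = E q n (\<lambda>h. - ln (likelihood p q h)) + E q n (\<lambda>h. \<Sum>a<A. pmf (\<sigma> h (cur h)) a * ?D h a)"
    by (rule Bochner_Integration.integral_add) simp_all
  finally show ?case using Suc.IH by simp
qed simp

text \<open>Given a jump, its target is uniform and independent of the likelihood, which ignores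
  targets; fixing the target yields the factor \<open>1 / S\<close>. Since \<open>w\<close> is
  nonnegative, the exit event can be added on the right.\<close>

lemma E_jumped_likelihood_le:
  assumes "exit_probs q" "s < S" "\<And>x. 0 < x \<Longrightarrow> 0 \<le> w x" "exit_probs p"
  shows "E q (Suc n) (\<lambda>h. jumped s h * w (likelihood p q h))
    \<le> E q (Suc n) (\<lambda>h. w (likelihood p q h)) / real S"
proof -
  have "step q (\<lambda>h. jumped s h * w (likelihood p q h)) h
      \<le> step q (\<lambda>h. w (likelihood p q h)) h / real S" for h
  proof -
    have "step q (\<lambda>h. jumped s h * w (likelihood p q h)) h
        \<le> (\<Sum>a<A. pmf (\<sigma> h (cur h)) a * (q (cur h) a * w (likelihood p q (h @ [(cur h, a, None)]))
          + (1 - q (cur h) a) * w (likelihood p q (h @ [(cur h, a, Some s)])))) / real S"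
      unfolding step_jumped[OF assms(2)] sum_divide_distrib
    proof (intro sum_mono)
      fix a
      have "0 \<le> q (cur h) a * w (likelihood p q (h @ [(cur h, a, None)]))"
        using exit_probsD[OF assms(1)] by (intro mult_nonneg_nonneg assms(3) likelihood_pos assms less_imp_le)
      then have "pmf (\<sigma> h (cur h)) a * ((1 - q (cur h) a) * w (likelihood p q (h @ [(cur h, a, Some s)]))) / real S
        \<le> pmf (\<sigma> h (cur h)) a * (q (cur h) a * w (likelihood p q (h @ [(cur h, a, None)]))
          + (1 - q (cur h) a) * w (likelihood p q (h @ [(cur h, a, Some s)]))) / real S"
        by (intro divide_right_mono mult_left_mono) auto
      then show "pmf (\<sigma> h (cur h)) a * ((1 - q (cur h) a) * (w (likelihood p q (h @ [(cur h, a, Some s)])) / real S))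
        \<le> pmf (\<sigma> h (cur h)) a * (q (cur h) a * w (likelihood p q (h @ [(cur h, a, None)]))
          + (1 - q (cur h) a) * w (likelihood p q (h @ [(cur h, a, Some s)]))) / real S"
        by (simp only: times_divide_eq_right)
    qed
    also have "\<dots> = step q (\<lambda>h. w (likelihood p q h)) h / real S"
      by (subst step_outcome) (auto simp: likelihood_step_def)
    finally show ?thesis .
  qed
  then have "E q n (step q (\<lambda>h. jumped s h * w (likelihood p q h)))
      \<le> E q n (\<lambda>h. step q (\<lambda>h. w (likelihood p q h)) h / real S)"
    by (intro E_mono)
  then show ?thesis by (simp add: E_Suc[OF assms(1)])
qed

end

section \<open>Planted instances and change of measure\<close>

text \<open>
  With \<open>y = sqrt x\<close>, Young's inequality splits \<open>x - 1 = (y - 1) (y + 1)\<close>, and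
  \<open>(y - 1)\<^sup>2 \<le> x - 1 - ln x\<close>. Applied to a likelihood ratio this replaces Pinsker's inequality by a
  bound that is linear in the divergence.
\<close>

lemma likelihood_ratio_bound:
  fixes x f :: real
  assumes "0 < x" "0 \<le> f" "f \<le> 1"
  shows "(x - 1) * f \<le> 64 * (x - 1 - ln x) + (x + 1) / 128"
    and "0 \<le> 64 * (x - 1 - ln x) + (x + 1) / 128"
proof -
  show nonneg: "0 \<le> 64 * (x - 1 - ln x) + (x + 1) / 128"
    using ln_le_minus_one[of x] assms(1) by simp
  define y where "y = sqrt x"
  have y: "0 < y" "x = y\<^sup>2" using assms(1) by (auto simp: y_def)
  have "ln x \<le> 2 * (y - 1)"
    using ln_le_minus_one[of y] y by (simp add: ln_realpow)
  then have "(y - 1)\<^sup>2 \<le> x - 1 - ln x"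
    by (simp add: y(2) power2_eq_square algebra_simps)
  moreover have "(y + 1)\<^sup>2 \<le> 2 * (x + 1)"
    using zero_le_power2[of "y - 1"] by (simp add: y(2) power2_eq_square algebra_simps)
  \<comment> \<open>Young's inequality: the cross term of the square has coefficient
    \<open>2 * 8 / 16 = 1\<close>.\<close>
  moreover have "x - 1 \<le> 64 * (y - 1)\<^sup>2 + (y + 1)\<^sup>2 / 256"
    using zero_le_power2[of "8 * (y - 1) - (y + 1) / 16"]
    by (simp add: y(2) power2_eq_square algebra_simps)
  ultimately have "x - 1 \<le> 64 * (x - 1 - ln x) + (x + 1) / 128" by argo
  moreover have "(x - 1) * f \<le> max 0 (x - 1)"
    using assms(2,3) by (cases "1 \<le> x") (auto simp: mult_left_le mult_nonpos_nonneg)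
  ultimately show "(x - 1) * f \<le> 64 * (x - 1 - ln x) + (x + 1) / 128"
    using nonneg by linarith
qed

definition planted :: "real \<Rightarrow> real \<Rightarrow> (nat \<Rightarrow> nat) \<Rightarrow> nat \<Rightarrow> nat \<Rightarrow> real" where
  "planted p d \<theta> s a = (if a = \<theta> s then p else p * (1 + d))"

text \<open>A reference law that does not depend on \<open>\<theta> s\<close>, so that one law is
  compared with all \<open>A\<close> values of that secret.\<close>

definition planted_except :: "real \<Rightarrow> real \<Rightarrow> nat \<Rightarrow> (nat \<Rightarrow> nat) \<Rightarrow> nat \<Rightarrow> nat \<Rightarrow> real" where
  "planted_except p d s \<theta> s' a = (if s' \<noteq> s \<and> a = \<theta> s' then p else p * (1 + d))"

context
  fixes p d :: real
  assumes pd: "0 < p" "0 \<le> d" "p * (1 + d) < 1"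
begin

lemma planted_bounds:
  "p \<le> planted p d \<theta> s a" "planted p d \<theta> s a \<le> p * (1 + d)"
  "p \<le> planted_except p d s' \<theta> s a" "planted_except p d s' \<theta> s a \<le> p * (1 + d)"
  using pd by (auto simp: planted_def planted_except_def)

lemma exit_probs_planted: "exit_probs (planted p d \<theta>)"
  and exit_probs_planted_except: "exit_probs (planted_except p d s \<theta>)"
  using pd planted_bounds by (smt (verit) exit_probs_def)+

lemma p_less_1: "p < 1"
  using mult_nonneg_nonneg[of p d] pd by (simp add: distrib_left del: mult_nonneg_nonneg zero_le_mult_iff)

text \<open>The kernels differ at the pair \<open>(s, a)\<close> only, where the exit probabilities
  are \<open>p * (1 + d)\<close> and \<open>p\<close>.\<close>

lemma planted_divergence:
  "(planted_except p d s \<theta> s' a' - planted p d (\<theta>(s := a)) s' a')\<^sup>2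
      / (planted p d (\<theta>(s := a)) s' a' * (1 - planted p d (\<theta>(s := a)) s' a'))
    = p * d\<^sup>2 / (1 - p) * of_bool (s' = s \<and> a' = a)"
  using pd(1) p_less_1 by (simp add: planted_def planted_except_def power2_eq_square field_simps)

end

context bandit_learner
begin

text \<open>Write the likelihood times \<open>f\<close> as \<open>f\<close> plus an excess. The
  excess is at most \<open>w\<close> of the likelihood, and the independent jump weights it by
  \<open>1 / S\<close>. The likelihood has mean 1 under \<open>q\<close>, so
  \<open>(x + 1) / 128\<close> contributes \<open>1 / 64\<close>.\<close>

lemma E_jumped_change_of_measure:
  assumes "exit_probs p" "exit_probs q" "s < S" "\<And>h. 0 \<le> f h \<and> f h \<le> 1"
  shows "E p (Suc n) (\<lambda>h. jumped s h * f h) \<le> E q (Suc n) (\<lambda>h. jumped s h * f h)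
    + (64 * E q (Suc n) (\<lambda>h. - ln (likelihood p q h)) + 1 / 64) / real S"
proof -
  define w :: "real \<Rightarrow> real" where "w x = 64 * (x - 1 - ln x) + (x + 1) / 128" for x
  have "E p (Suc n) (\<lambda>h. jumped s h * f h) = E q (Suc n) (\<lambda>h. likelihood p q h * (jumped s h * f h))"
    by (rule change_of_measure[OF assms(1,2)])
  also have "\<dots> \<le> E q (Suc n) (\<lambda>h. jumped s h * f h + jumped s h * w (likelihood p q h))"
  proof (rule E_mono)
    fix h
    have "jumped s h * ((likelihood p q h - 1) * f h) \<le> jumped s h * w (likelihood p q h)"
      unfolding w_def using assms(4) likelihood_pos[OF assms(1,2)]
      by (intro mult_left_mono likelihood_ratio_bound jumped_bounds) auto
    then show "likelihood p q h * (jumped s h * f h) \<le> jumped s h * f h + jumped s h * w (likelihood p q h)"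
      by (simp add: algebra_simps)
  qed
  also have "\<dots> = E q (Suc n) (\<lambda>h. jumped s h * f h) + E q (Suc n) (\<lambda>h. jumped s h * w (likelihood p q h))"
    by simp
  also have "E q (Suc n) (\<lambda>h. jumped s h * w (likelihood p q h)) \<le> E q (Suc n) (\<lambda>h. w (likelihood p q h)) / real S"
    using likelihood_ratio_bound(2)[of _ 0]
    by (intro E_jumped_likelihood_le assms) (auto simp: w_def)
  also have "E q (Suc n) (\<lambda>h. w (likelihood p q h)) = 64 * E q (Suc n) (\<lambda>h. - ln (likelihood p q h)) + 1 / 64"
  proof -
    have "E q (Suc n) (likelihood p q) = 1"
      using change_of_measure[OF assms(1,2), of "Suc n" "\<lambda>_. 1"] by simp
    then show ?thesis by (simp add: w_def)
  qed
  finally show ?thesis by simp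
qed

text \<open>The conditional probability of missing the secret at the next step, as that action is
  not yet part of \<open>h\<close>.\<close>

definition wrong :: "(nat \<Rightarrow> nat) \<Rightarrow> (nat, nat) history \<Rightarrow> real" where
  "wrong \<theta> h = 1 - pmf (\<sigma> h (cur h)) (\<theta> (cur h))"

lemma wrong_bounds: "0 \<le> wrong \<theta> h" "wrong \<theta> h \<le> 1"
  by (simp_all add: wrong_def pmf_le_1)

context
  fixes p d :: real
  assumes pd: "0 < p" "0 \<le> d" "p * (1 + d) < 1"
begin

text \<open>Under the reference law the hits, summed over the \<open>A\<close> candidate secrets of
  \<open>s\<close>, add up to the jumps into \<open>s\<close>, at most
  \<open>(1 - p) / real S\<close>. The other terms are the information gained and \<open>A\<close>
  copies of \<open>1 / 64\<close>.\<close>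

lemma correct_pulls_le:
  assumes "s < S"
  shows "(\<Sum>a<A. E (planted p d (\<theta>(s := a))) (Suc n) (\<lambda>h. jumped s h * pmf (\<sigma> h s) a))
    \<le> ((1 - p) + 64 * (p * d\<^sup>2 / (1 - p) * (real (Suc n) * (1 / real S + of_bool (s = s\<^sub>0)))) + real A / 64) / real S"
proof -
  let ?q = "planted_except p d s \<theta>" and ?p = "\<lambda>a. planted p d (\<theta>(s := a))"
  define k where "k = p * d\<^sup>2 / (1 - p)"
  note q = exit_probs_planted_except[OF pd, of s \<theta>] and p = exit_probs_planted[OF pd]
  have k: "0 \<le> k" using pd p_less_1[OF pd] by (simp add: k_def)
  have "(\<Sum>a<A. E ?q (Suc n) (\<lambda>h. - ln (likelihood (?p a) ?q h)))
      \<le> (\<Sum>a<A. \<Sum>t<Suc n. E ?q t (\<lambda>h. \<Sum>a'<A. pmf (\<sigma> h (cur h)) a' * (k * of_bool (cur h = s \<and> a' = a))))"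
    by (intro sum_mono order_trans[OF E_neg_ln_likelihood_le[OF p q]])
       (simp only: planted_divergence[OF pd] k_def order_refl)
  also have "\<dots> = (\<Sum>t<Suc n. \<Sum>a<A. E ?q t (\<lambda>h. \<Sum>a'<A. pmf (\<sigma> h (cur h)) a' * (k * of_bool (cur h = s \<and> a' = a))))"
    by (rule sum.swap)
  \<comment> \<open>An action played in \<open>s\<close> informs only about the hypothesis that
    makes it the secret, so the divergences of all \<open>A\<close> hypotheses together amount to
    one \<open>k\<close> per visit to \<open>s\<close>.\<close>
  also have "\<dots> = (\<Sum>t<Suc n. E ?q t (\<lambda>h. k * of_bool (cur h = s)))"
  proof (rule sum.cong[OF refl])
    fix t
    have "(\<Sum>a<A. \<Sum>a'<A. pmf (\<sigma> h (cur h)) a' * (k * of_bool (cur h = s \<and> a' = a))) = k * of_bool (cur h = s)"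
      if h: "cur h < S" for h
    proof -
      have "(\<Sum>a<A. \<Sum>a'<A. pmf (\<sigma> h (cur h)) a' * (k * of_bool (cur h = s \<and> a' = a)))
          = (\<Sum>a'<A. \<Sum>a<A. pmf (\<sigma> h (cur h)) a' * (k * of_bool (cur h = s \<and> a' = a)))"
        by (rule sum.swap)
      also have "\<dots> = (\<Sum>a'<A. pmf (\<sigma> h (cur h)) a' * (k * of_bool (cur h = s)))"
      proof (rule sum.cong[OF refl])
        fix a' assume "a' \<in> {..<A}"
        then show "(\<Sum>a<A. pmf (\<sigma> h (cur h)) a' * (k * of_bool (cur h = s \<and> a' = a)))
            = pmf (\<sigma> h (cur h)) a' * (k * of_bool (cur h = s))"
          by (subst sum.remove[of _ a']) (auto intro!: sum.neutral)
      qed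
      finally show ?thesis by (simp only: sum_actions_le[OF h])
    qed
    note total = this
    have "(\<Sum>a<A. E ?q t (\<lambda>h. \<Sum>a'<A. pmf (\<sigma> h (cur h)) a' * (k * of_bool (cur h = s \<and> a' = a))))
        = E ?q t (\<lambda>h. \<Sum>a<A. \<Sum>a'<A. pmf (\<sigma> h (cur h)) a' * (k * of_bool (cur h = s \<and> a' = a)))"
      by (rule Bochner_Integration.integral_sum[symmetric]) simp
    also have "\<dots> = E ?q t (\<lambda>h. k * of_bool (cur h = s))"
      by (rule E_cong) (rule total)
    finally show "(\<Sum>a<A. E ?q t (\<lambda>h. \<Sum>a'<A. pmf (\<sigma> h (cur h)) a' * (k * of_bool (cur h = s \<and> a' = a))))
        = E ?q t (\<lambda>h. k * of_bool (cur h = s))" .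
  qed
  also have "\<dots> \<le> (\<Sum>t<Suc n. k * (1 / real S + of_bool (s = s\<^sub>0)))"
    unfolding integral_mult_right_zero by (intro sum_mono mult_left_mono E_current_state_le q assms k)
  finally have info: "(\<Sum>a<A. E ?q (Suc n) (\<lambda>h. - ln (likelihood (?p a) ?q h)))
      \<le> k * (real (Suc n) * (1 / real S + of_bool (s = s\<^sub>0)))"
    by (simp add: mult.left_commute)
  have "(\<Sum>a<A. E ?q (Suc n) (\<lambda>h. jumped s h * pmf (\<sigma> h s) a))
      = E ?q (Suc n) (\<lambda>h. \<Sum>a<A. jumped s h * pmf (\<sigma> h s) a)"
    by (subst Bochner_Integration.integral_sum) auto
  also have "\<dots> = E ?q (Suc n) (jumped s)"
    using sum_actions[OF assms] by (simp flip: sum_distrib_left)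
  also have "\<dots> \<le> (1 - p) / real S"
    by (rule E_jumped_bounds(1)[OF q assms planted_bounds(3,4)[OF pd]])
  finally have jump: "(\<Sum>a<A. E ?q (Suc n) (\<lambda>h. jumped s h * pmf (\<sigma> h s) a)) \<le> (1 - p) / real S" .
  have "(\<Sum>a<A. E (?p a) (Suc n) (\<lambda>h. jumped s h * pmf (\<sigma> h s) a))
      \<le> (\<Sum>a<A. E ?q (Suc n) (\<lambda>h. jumped s h * pmf (\<sigma> h s) a)
        + (64 * E ?q (Suc n) (\<lambda>h. - ln (likelihood (?p a) ?q h)) + 1 / 64) / real S)"
    by (intro sum_mono E_jumped_change_of_measure p q assms) (auto simp: pmf_le_1)
  also have "\<dots> = (\<Sum>a<A. E ?q (Suc n) (\<lambda>h. jumped s h * pmf (\<sigma> h s) a))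
      + (64 * (\<Sum>a<A. E ?q (Suc n) (\<lambda>h. - ln (likelihood (?p a) ?q h))) + real A / 64) / real S"
    unfolding sum.distrib sum_divide_distrib[symmetric] sum_distrib_left[symmetric] by simp
  also have "\<dots> \<le> (1 - p) / real S + (64 * (k * (real (Suc n) * (1 / real S + of_bool (s = s\<^sub>0)))) + real A / 64) / real S"
    using jump info by (intro add_mono divide_right_mono mult_left_mono order_refl) auto
  also have "\<dots> = ((1 - p) + 64 * (k * (real (Suc n) * (1 / real S + of_bool (s = s\<^sub>0)))) + real A / 64) / real S"
    by (simp add: add_divide_distrib)
  finally show ?thesis unfolding k_def .
qed

text \<open>From the probability of a jump, at least \<open>1 - p * (1 + d)\<close>, subtract the
  jumps followed by a hit and the event that all \<open>K\<close> episodes are over.\<close>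

lemma wrong_pulls_ge:
  assumes "0 < K"
  shows "(1 - p * (1 + d)) - (\<Sum>s<S. E (planted p d \<theta>) (Suc n) (\<lambda>h. jumped s h * pmf (\<sigma> h s) (\<theta> s)))
      - real (Suc n) * (p * (1 + d)) / real K
    \<le> E (planted p d \<theta>) (Suc n) (\<lambda>h. of_bool (terminations h < K) * wrong \<theta> h)"
proof -
  let ?p = "planted p d \<theta>"
  note p = exit_probs_planted[OF pd, of \<theta>]
  have "(\<Sum>s<S. (1 - p * (1 + d)) / real S) \<le> (\<Sum>s<S. E ?p (Suc n) (jumped s))"
    by (intro sum_mono E_jumped_bounds(2)[OF p _ planted_bounds(1,2)[OF pd]]) auto
  then have "1 - p * (1 + d) \<le> (\<Sum>s<S. E ?p (Suc n) (jumped s))"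
    using S_pos by simp
  moreover have "E ?p (Suc n) (\<lambda>h. of_bool (K \<le> terminations h)) \<le> real (Suc n) * (p * (1 + d)) / real K"
    by (rule finished_le[OF p planted_bounds(2)[OF pd] assms])
  moreover have "E ?p (Suc n) (\<lambda>h. (\<Sum>s<S. jumped s h - jumped s h * pmf (\<sigma> h s) (\<theta> s)) - of_bool (K \<le> terminations h))
      \<le> E ?p (Suc n) (\<lambda>h. of_bool (terminations h < K) * wrong \<theta> h)"
  proof (rule E_mono)
    fix h assume h: "cur h < S"
    have "(\<Sum>s<S. jumped s h * (1 - pmf (\<sigma> h s) (\<theta> s))) = jumped (cur h) h * wrong \<theta> h"
      using h jumped_current[of _ h] by (subst sum.remove[of _ "cur h"]) (auto simp: wrong_def intro!: sum.neutral)
    also have "\<dots> \<le> wrong \<theta> h"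
      by (intro mult_left_le_one_le jumped_bounds) (simp add: wrong_def pmf_le_1)
    finally show "(\<Sum>s<S. jumped s h - jumped s h * pmf (\<sigma> h s) (\<theta> s)) - of_bool (K \<le> terminations h)
        \<le> of_bool (terminations h < K) * wrong \<theta> h"
      using wrong_bounds[of \<theta> h] by (cases "K \<le> terminations h") (auto simp: algebra_simps)
  qed
  ultimately show ?thesis
    by (simp add: sum_subtractf)
qed

section \<open>Total length and the cost of misses\<close>

text \<open>\<open>E_terminations\<close> with exit probability
  \<open>p + p * d * wrong \<theta> h\<close>: each expected miss shortens the total length by
  \<open>d\<close>.\<close>

lemma unfinished_planted:
  "p * (\<Sum>t<n. unfinished (bandit_sp S A (planted p d \<theta>)) s\<^sub>0 \<sigma> K t)
    = E (planted p d \<theta>) n (\<lambda>h. real (min (terminations h) K))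
      - p * d * (\<Sum>t<n. E (planted p d \<theta>) t (\<lambda>h. of_bool (terminations h < K) * wrong \<theta> h))"
proof -
  let ?p = "planted p d \<theta>"
  have rate: "(\<Sum>a<A. pmf (\<sigma> h (cur h)) a * ?p (cur h) a) = p + p * d * wrong \<theta> h" if h: "cur h < S" for h
  proof -
    have "(\<Sum>a<A. pmf (\<sigma> h (cur h)) a * ?p (cur h) a)
        = (\<Sum>a<A. pmf (\<sigma> h (cur h)) a * (p * (1 + d)) - p * d * (if a = \<theta> (cur h) then pmf (\<sigma> h (cur h)) a else 0))"
      by (intro sum.cong refl) (auto simp: planted_def algebra_simps)
    also have "\<dots> = p * (1 + d) - p * d * (\<Sum>a<A. if a = \<theta> (cur h) then pmf (\<sigma> h (cur h)) a else 0)"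
      by (simp only: sum_subtractf sum_actions_le[OF h] sum_distrib_left)
    also have "(\<Sum>a<A. if a = \<theta> (cur h) then pmf (\<sigma> h (cur h)) a else 0) = pmf (\<sigma> h (cur h)) (\<theta> (cur h))"
      using actions[OF h, of h] by (auto simp: set_pmf_eq)
    finally show ?thesis by (simp add: wrong_def algebra_simps)
  qed
  have "E ?p n (\<lambda>h. real (min (terminations h) K)) = (\<Sum>t<n. E ?p t (\<lambda>h. of_bool (terminations h < K)
      * (\<Sum>a<A. pmf (\<sigma> h (cur h)) a * ?p (cur h) a)))"
    by (rule E_terminations[OF exit_probs_planted[OF pd]])
  also have "\<dots> = (\<Sum>t<n. E ?p t (\<lambda>h. p * of_bool (terminations h < K)
      + p * d * (of_bool (terminations h < K) * wrong \<theta> h)))"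
    by (intro sum.cong refl E_cong) (simp add: rate algebra_simps)
  also have "\<dots> = (\<Sum>t<n. p * E ?p t (\<lambda>h. of_bool (terminations h < K))
      + p * d * E ?p t (\<lambda>h. of_bool (terminations h < K) * wrong \<theta> h))"
    by (intro sum.cong refl) (subst Bochner_Integration.integral_add, auto)
  finally show ?thesis
    by (simp add: unfinished_eq sum.distrib sum_distrib_left)
qed

text \<open>The nonnegative penalty may be cut at an earlier horizon, so \<open>n\<close> can tend
  to infinity while the penalty stays a finite sum.\<close>

lemma sum_unfinished_le:
  assumes "n\<^sub>0 \<le> n"
  shows "(\<Sum>t<n. unfinished (bandit_sp S A (planted p d \<theta>)) s\<^sub>0 \<sigma> K t)
    \<le> real K / p - d * (\<Sum>t<n\<^sub>0. E (planted p d \<theta>) t (\<lambda>h. of_bool (terminations h < K) * wrong \<theta> h))"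
proof -
  let ?G = "\<lambda>n. \<Sum>t<n. E (planted p d \<theta>) t (\<lambda>h. of_bool (terminations h < K) * wrong \<theta> h)"
  have "?G n\<^sub>0 \<le> ?G n"
    using assms by (intro sum_mono2) (auto intro!: integral_nonneg_AE simp: wrong_bounds)
  then have "d * ?G n\<^sub>0 \<le> d * ?G n" using pd by (intro mult_left_mono) auto
  moreover have "E (planted p d \<theta>) n (\<lambda>h. real (min (terminations h) K)) \<le> E (planted p d \<theta>) n (\<lambda>_. real K)"
    by (intro E_mono) auto
  then have "p * (\<Sum>t<n. unfinished (bandit_sp S A (planted p d \<theta>)) s\<^sub>0 \<sigma> K t) \<le> real K - p * d * ?G n"
    using unfinished_planted[where n=n and \<theta>=\<theta> and K=K] by simp
  then have "(\<Sum>t<n. unfinished (bandit_sp S A (planted p d \<theta>)) s\<^sub>0 \<sigma> K t) \<le> real K / p - d * ?G n"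
    using pd(1) by (simp add: field_simps)
  ultimately show ?thesis by linarith
qed

lemma summable_unfinished: "summable (unfinished (bandit_sp S A (planted p d \<theta>)) s\<^sub>0 \<sigma> K)"
  using sum_unfinished_le[of 0 _ \<theta> K] by (intro summableI_nonneg_bounded unfinished_nonneg) simp

lemma suminf_unfinished_le:
  "(\<Sum>t. unfinished (bandit_sp S A (planted p d \<theta>)) s\<^sub>0 \<sigma> K t)
    \<le> real K / p - d * (\<Sum>t<n. E (planted p d \<theta>) t (\<lambda>h. of_bool (terminations h < K) * wrong \<theta> h))"
proof (rule suminf_le_const[OF summable_unfinished])
  fix m
  have "(\<Sum>t<m. unfinished (bandit_sp S A (planted p d \<theta>)) s\<^sub>0 \<sigma> K t)
      \<le> (\<Sum>t<max m n. unfinished (bandit_sp S A (planted p d \<theta>)) s\<^sub>0 \<sigma> K t)"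
    by (intro sum_mono2) (auto simp: unfinished_nonneg)
  also have "\<dots> \<le> real K / p - d * (\<Sum>t<n. E (planted p d \<theta>) t (\<lambda>h. of_bool (terminations h < K) * wrong \<theta> h))"
    by (rule sum_unfinished_le) simp
  finally show "(\<Sum>t<m. unfinished (bandit_sp S A (planted p d \<theta>)) s\<^sub>0 \<sigma> K t)
    \<le> real K / p - d * (\<Sum>t<n. E (planted p d \<theta>) t (\<lambda>h. of_bool (terminations h < K) * wrong \<theta> h))" .
qed

text \<open>Without misses the finite-horizon identity has no penalty, and the survival probability
  tends to 0. This is the value of playing every secret.\<close>

lemma suminf_unfinished_no_wrong:
  assumes "\<And>h. wrong \<theta> h = 0"
  shows "(\<Sum>t. unfinished (bandit_sp S A (planted p d \<theta>)) s\<^sub>0 \<sigma> 1 t) = 1 / p"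
proof -
  let ?u = "unfinished (bandit_sp S A (planted p d \<theta>)) s\<^sub>0 \<sigma> 1"
  have "(\<Sum>t<n. ?u t) = (1 - ?u n) / p" for n
  proof -
    have "E (planted p d \<theta>) n (\<lambda>h. real (min (terminations h) 1))
        = E (planted p d \<theta>) n (\<lambda>h. 1 - of_bool (terminations h < 1))"
      by (intro E_cong) auto
    also have "\<dots> = 1 - ?u n" by (simp add: unfinished_eq)
    finally show ?thesis
      using unfinished_planted[where n=n and \<theta>=\<theta> and K=1] assms pd(1) by (simp add: field_simps)
  qed
  moreover have "(\<lambda>n. (1 - ?u n) / p) \<longlonglongrightarrow> (1 - 0) / p"
    by (intro tendsto_intros summable_LIMSEQ_zero[OF summable_unfinished]) (use pd in simp)
  ultimately have "(\<lambda>n. \<Sum>t<n. ?u t) \<longlonglongrightarrow> 1 / p" by simp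
  then show ?thesis
    using summable_LIMSEQ[OF summable_unfinished] LIMSEQ_unique by blast
qed

text \<open>Survival is at most geometric for every \<open>\<sigma>\<close>, and
  \<open>2 t + 1\<close> is at most \<open>2 (t + 1)\<close>, which leaves the derivative of the
  geometric series.\<close>

lemma second_moment_le:
  "(\<Sum>t. ennreal ((2 * real t + 1) * unfinished (bandit_sp S A (planted p d \<theta>)) s\<^sub>0 \<sigma> 1 t))
    \<le> ennreal (2 / p\<^sup>2)"
proof -
  have q: "norm (1 - p) < 1" "0 \<le> 1 - p" using pd(1) p_less_1[OF pd] by auto
  have sums: "(\<lambda>t. 2 * (real (Suc t) * (1 - p) ^ t)) sums (2 / p\<^sup>2)"
    using sums_mult[OF geometric_deriv_sums[OF q(1)], of 2] by simp
  have "(\<Sum>t. ennreal ((2 * real t + 1) * unfinished (bandit_sp S A (planted p d \<theta>)) s\<^sub>0 \<sigma> 1 t))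
      \<le> (\<Sum>t. ennreal (2 * (real (Suc t) * (1 - p) ^ t)))"
  proof (intro suminf_le summableI ennreal_leI)
    fix t
    have "unfinished (bandit_sp S A (planted p d \<theta>)) s\<^sub>0 \<sigma> 1 t \<le> (1 - p) ^ t"
      unfolding unfinished_eq by (rule survival_le[OF exit_probs_planted[OF pd] planted_bounds(1)[OF pd]])
    then have "(2 * real t + 1) * unfinished (bandit_sp S A (planted p d \<theta>)) s\<^sub>0 \<sigma> 1 t
        \<le> (2 * real (Suc t)) * (1 - p) ^ t"
      by (intro mult_mono) (auto simp: unfinished_nonneg)
    then show "(2 * real t + 1) * unfinished (bandit_sp S A (planted p d \<theta>)) s\<^sub>0 \<sigma> 1 t
        \<le> 2 * (real (Suc t) * (1 - p) ^ t)"
      by (simp only: mult.assoc)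
  qed
  also have "\<dots> = ennreal (2 / p\<^sup>2)"
    using sums q(2) by (subst suminf_ennreal2) (auto simp: sums_iff)
  finally show ?thesis .
qed

end

end

section \<open>The lower bound\<close>

text \<open>Resampling one coordinate preserves the uniform law on a product; the bijection swaps
  \<open>b\<close> with coordinate \<open>i\<close> and is an involution.\<close>

lemma sum_PiE_update:
  fixes f :: "('i \<Rightarrow> 'b) \<Rightarrow> real"
  assumes "i \<in> I"
  shows "(\<Sum>\<theta>\<in>PiE I (\<lambda>_. B). \<Sum>b\<in>B. f (\<theta>(i := b))) = real (card B) * (\<Sum>\<theta>\<in>PiE I (\<lambda>_. B). f \<theta>)"
proof -
  have "(\<Sum>\<theta>\<in>PiE I (\<lambda>_. B). \<Sum>b\<in>B. f (\<theta>(i := b)))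
      = (\<Sum>(\<theta>, b)\<in>PiE I (\<lambda>_. B) \<times> B. f (\<theta>(i := b)))"
    by (rule sum.cartesian_product)
  also have "\<dots> = (\<Sum>(\<theta>, b)\<in>PiE I (\<lambda>_. B) \<times> B. f \<theta>)"
    using assms
    by (intro sum.reindex_bij_witness[where i="\<lambda>(\<theta>, b). (\<theta>(i := b), \<theta> i)" and j="\<lambda>(\<theta>, b). (\<theta>(i := b), \<theta> i)"])
       (auto simp: PiE_iff extensional_def)
  also have "\<dots> = (\<Sum>\<theta>\<in>PiE I (\<lambda>_. B). \<Sum>b\<in>B. f \<theta>)"
    by (rule sum.cartesian_product[symmetric])
  finally show ?thesis by (simp add: sum_distrib_left)
qed

context bandit_learner
begin

text \<open>\<open>info\<close> keeps the gathered information too small to reveal the secrets, and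
  \<open>time\<close> makes it unlikely that all \<open>K\<close> episodes are over; a random secret
  is then still missed with at least constant probability.\<close>

lemma average_wrong_pulls_ge:
  assumes pd: "0 < p" "p \<le> 3 / 4" "0 \<le> d" "d \<le> 1 / 24" and A: "2 \<le> A" and K: "0 < K"
    and info: "128 * (p * d\<^sup>2 / (1 - p)) * real (Suc n) \<le> real S * real A / 64"
    and time: "real (Suc n) * p \<le> real K / 64"
  shows "real (card (PiE {..<S} (\<lambda>_. {..<A}))) / 32 \<le> (\<Sum>\<theta>\<in>PiE {..<S} (\<lambda>_. {..<A}).
    E (planted p d \<theta>) (Suc n) (\<lambda>h. of_bool (terminations h < K) * wrong \<theta> h))"
proof -
  let ?\<Theta> = "PiE {..<S} (\<lambda>_. {..<A})"
  define N where "N = real (card ?\<Theta>)"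
  define k where "k = p * d\<^sup>2 / (1 - p)"
  define I where "I = 128 * k * real (Suc n)"
  have pd': "0 < p" "0 \<le> d" "p * (1 + d) < 1"
    using pd mult_mono[of p "3/4" "1 + d" "25/24"] by auto
  let ?g = "\<lambda>s \<theta>. E (planted p d \<theta>) (Suc n) (\<lambda>h. jumped s h * pmf (\<sigma> h s) (\<theta> s))"
  have g: "(\<Sum>\<theta>\<in>?\<Theta>. ?g s \<theta>) \<le> N / real A * (((1 - p) + 64 * (k * (real (Suc n) * (1 / real S + of_bool (s = s\<^sub>0))))
      + real A / 64) / real S)" if "s < S" for s
  proof -
    have "real A * (\<Sum>\<theta>\<in>?\<Theta>. ?g s \<theta>) = (\<Sum>\<theta>\<in>?\<Theta>. \<Sum>a<A. ?g s (\<theta>(s := a)))"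
      using sum_PiE_update[of s "{..<S}" "?g s" "{..<A}"] that by simp
    also have "\<dots> = (\<Sum>\<theta>\<in>?\<Theta>. \<Sum>a<A. E (planted p d (\<theta>(s := a))) (Suc n) (\<lambda>h. jumped s h * pmf (\<sigma> h s) a))"
      by simp
    also have "\<dots> \<le> (\<Sum>\<theta>\<in>?\<Theta>. ((1 - p) + 64 * (k * (real (Suc n) * (1 / real S + of_bool (s = s\<^sub>0))))
        + real A / 64) / real S)"
      unfolding k_def by (intro sum_mono correct_pulls_le pd' that)
    also have "\<dots> = N * (((1 - p) + 64 * (k * (real (Suc n) * (1 / real S + of_bool (s = s\<^sub>0))))
        + real A / 64) / real S)"
      by (simp add: N_def)
    finally have *: "real A * (\<Sum>\<theta>\<in>?\<Theta>. ?g s \<theta>) \<le> \<dots>" .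
    have "x \<le> N / a * c" if "a * x \<le> N * c" "0 < a" for a x c :: real
      using that by (simp add: field_simps)
    from this[OF *] show ?thesis using A by simp
  qed
  have "(\<Sum>\<theta>\<in>?\<Theta>. \<Sum>s<S. ?g s \<theta>) = (\<Sum>s<S. \<Sum>\<theta>\<in>?\<Theta>. ?g s \<theta>)"
    by (rule sum.swap)
  also have "\<dots> \<le> (\<Sum>s<S. N / real A * (((1 - p) + 64 * (k * (real (Suc n) * (1 / real S + of_bool (s = s\<^sub>0))))
      + real A / 64) / real S))"
    by (intro sum_mono g) simp
  also have "\<dots> = N / real A * (((\<Sum>s<S. 1 - p) + 64 * (k * (real (Suc n) * ((\<Sum>s<S. 1 / real S) + (\<Sum>s<S. of_bool (s = s\<^sub>0)))))
      + (\<Sum>s<S. real A / 64)) / real S)"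
    by (simp only: sum_distrib_left[symmetric] sum_divide_distrib[symmetric] sum.distrib)
  \<comment> \<open>Both inner sums over states equal 1, which turns 64 into the 128 in
    \<open>I\<close>.\<close>
  also have "\<dots> = N / real A * ((real S * (1 - p) + I + real S * real A / 64) / real S)"
  proof -
    have "(\<Sum>s<S. of_bool (s = s\<^sub>0)) = (1::real)"
      using s0 by (subst sum.remove[of _ "s\<^sub>0"]) (auto intro!: sum.neutral)
    then show ?thesis using S_pos by (simp add: I_def)
  qed
  also have "\<dots> \<le> N / real A * ((real S * (1 - p) + real S * real A / 64 + real S * real A / 64) / real S)"
    using info by (intro mult_left_mono divide_right_mono add_mono order_refl) (auto simp: I_def k_def N_def)
  also have "\<dots> = N * ((1 - p) / real A + 1 / 32)"
    using S_pos A by (simp add: field_simps)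
  \<comment> \<open>With at least two actions a blind guess is right at most half of the
    time.\<close>
  also have "\<dots> \<le> N * ((1 - p) / 2 + 1 / 32)"
    using A pd by (intro mult_left_mono add_mono divide_left_mono order_refl) (auto simp: N_def)
  finally have correct: "(\<Sum>\<theta>\<in>?\<Theta>. \<Sum>s<S. ?g s \<theta>) \<le> N * ((1 - p) / 2 + 1 / 32)" .
  have late: "real (Suc n) * (p * (1 + d)) / real K \<le> 1 / 32"
  proof -
    have "real (Suc n) * p * (1 + d) \<le> real K / 64 * (25 / 24)"
      using time pd by (intro mult_mono) auto
    then show ?thesis using K by (simp add: field_simps)
  qed
  have pd24: "p * d \<le> 3 / 4 * (1 / 24)" using pd by (intro mult_mono) auto
  have "N / 32 \<le> N * ((1 - p * (1 + d)) - 1 / 32 - ((1 - p) / 2 + 1 / 32))"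
  proof -
    \<comment> \<open>The right side is \<open>(1 - p) / 2 - p * d - 1 / 16\<close>; at
      \<open>p = 3 / 4\<close> and \<open>p * d = 1 / 32\<close> it equals
      \<open>1 / 32\<close>.\<close>
    have "1 / 32 \<le> (1 - p * (1 + d)) - 1 / 32 - ((1 - p) / 2 + 1 / 32)"
      using pd pd24 unfolding distrib_left by argo
    then show ?thesis
      using mult_left_mono[of "1 / 32" _ N] by (simp add: N_def)
  qed
  also have "\<dots> = N * ((1 - p * (1 + d)) - 1 / 32) - N * ((1 - p) / 2 + 1 / 32)"
    by (rule right_diff_distrib)
  also have "\<dots> \<le> N * ((1 - p * (1 + d)) - 1 / 32) - (\<Sum>\<theta>\<in>?\<Theta>. \<Sum>s<S. ?g s \<theta>)"
    using correct by (rule diff_left_mono)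
  also have "\<dots> = (\<Sum>\<theta>\<in>?\<Theta>. (1 - p * (1 + d)) - (\<Sum>s<S. ?g s \<theta>) - 1 / 32)"
    by (simp only: sum_subtractf sum_constant N_def of_nat_id right_diff_distrib)
  also have "\<dots> \<le> (\<Sum>\<theta>\<in>?\<Theta>. E (planted p d \<theta>) (Suc n) (\<lambda>h. of_bool (terminations h < K) * wrong \<theta> h))"
    by (intro sum_mono order_trans[OF _ wrong_pulls_ge[OF pd' K]] diff_left_mono late)
  finally show ?thesis by (simp add: N_def)
qed

end

section \<open>Policies on planted instances: properness, optimal value, return scale\<close>

lemma bandit_learner_policy:
  assumes "\<pi> \<in> HD_policies (bandit_sp S A q)" "s < S"
  shows "bandit_learner S A s (\<lambda>h x. return_pmf (\<pi> h x))"
  using assms by unfold_locales (auto simp: HD_policies_def)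

context
  fixes S A :: nat and p d :: real
  assumes pd: "0 < p" "0 \<le> d" "p * (1 + d) < 1" and S: "1 \<le> S" and A: "1 \<le> A"
begin

lemma sp_instance_planted: "sp_instance (bandit_sp S A (planted p d \<theta>))"
proof -
  have "proper (bandit_sp S A (planted p d \<theta>)) \<pi>" if \<pi>: "\<pi> \<in> HD_policies (bandit_sp S A (planted p d \<theta>))" for \<pi>
    unfolding proper_def policy_run_def
  proof
    fix s assume "s \<in> states (bandit_sp S A (planted p d \<theta>))"
    then interpret bandit_learner S A s "\<lambda>h x. return_pmf (\<pi> h x)"
      using bandit_learner_policy[OF \<pi>] by simp
    have "\<exists>t. outcome (\<omega> t) = None" if ex: "\<exists>t. 1 \<le> terminations (map \<omega> [0..<t])"
      for \<omega> :: "nat \<Rightarrow> (nat, nat) step"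
    proof -
      obtain t where "1 \<le> terminations (map \<omega> [0..<t])" using ex by blast
      then show ?thesis using terminations_map_lessD[of 0 t \<omega>] by auto
    qed
    then show "AE \<omega> in run (bandit_sp S A (planted p d \<theta>)) s (\<lambda>h x. return_pmf (\<pi> h x)). \<exists>t. outcome (\<omega> t) = None"
      by (rule AE_mp[OF AE_terminations[OF summable_unfinished[OF pd, of \<theta> 1]] AE_I2[OF impI]])
  qed
  moreover have "set_pmf (exit_or_jump S q) \<subseteq> insert None (Some ` {..<S})" for q
    using S by (intro set_pmf_exit_or_jump) simp
  ultimately show ?thesis
    using S A by (simp add: sp_instance_def lessThan_empty_iff)
qed

lemma policy_value_planted:
  assumes "\<pi> \<in> HD_policies (bandit_sp S A (planted p d \<theta>))" "s < S"
  shows "policy_value (bandit_sp S A (planted p d \<theta>)) \<pi> s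
    = (\<Sum>t. unfinished (bandit_sp S A (planted p d \<theta>)) s (\<lambda>h x. return_pmf (\<pi> h x)) 1 t)"
proof -
  interpret bandit_learner S A s "\<lambda>h x. return_pmf (\<pi> h x)"
    by (rule bandit_learner_policy[OF assms])
  show ?thesis
    using has_bochner_integral_returns[OF summable_unfinished[OF pd, of \<theta> 1]]
    by (simp add: policy_value_def policy_run_def has_bochner_integral_iff)
qed

lemma policy_value_planted_le:
  assumes "\<pi> \<in> HD_policies (bandit_sp S A (planted p d \<theta>))" "s < S"
  shows "policy_value (bandit_sp S A (planted p d \<theta>)) \<pi> s \<le> 1 / p"
proof -
  interpret bandit_learner S A s "\<lambda>h x. return_pmf (\<pi> h x)"
    by (rule bandit_learner_policy[OF assms])
  show ?thesis
    using suminf_unfinished_le[OF pd, of \<theta> 1 0] by (simp add: policy_value_planted[OF assms])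
qed

lemma policy_value_planted_opt:
  assumes "\<theta> \<in> {..<S} \<rightarrow> {..<A}" "s < S"
  shows "policy_value (bandit_sp S A (planted p d \<theta>)) (\<lambda>_. \<theta>) s = 1 / p"
proof -
  have \<pi>: "(\<lambda>_. \<theta>) \<in> HD_policies (bandit_sp S A (planted p d \<theta>))"
    using assms by (auto simp: HD_policies_def)
  interpret bandit_learner S A s "\<lambda>h x. return_pmf (\<theta> x)"
    by (rule bandit_learner_policy[OF \<pi> assms(2)])
  show ?thesis
    using suminf_unfinished_no_wrong[OF pd, of \<theta>]
    by (simp add: policy_value_planted[OF \<pi> assms(2)] wrong_def)
qed

text \<open>\<open>optimal_value\<close> goes through \<open>SOME\<close>, so existence comes first:
  \<open>\<theta>\<close> attains \<open>1 / p\<close>, which no policy exceeds. The chosen policy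
  is then at least as good as \<open>\<theta>\<close>.\<close>

lemma optimal_value_planted_ge:
  assumes "\<theta> \<in> {..<S} \<rightarrow> {..<A}"
  shows "1 / p \<le> optimal_value (bandit_sp S A (planted p d \<theta>)) 0"
proof -
  let ?M = "bandit_sp S A (planted p d \<theta>)"
  have "optimal_stationary ?M \<theta>"
    unfolding optimal_stationary_def
    using assms policy_value_planted_le policy_value_planted_opt[OF assms] by auto
  then have "optimal_stationary ?M (SOME f. optimal_stationary ?M f)"
    by (rule someI[where P="optimal_stationary ?M"])
  moreover have "(\<lambda>_. \<theta>) \<in> HD_policies ?M"
    using assms by (auto simp: HD_policies_def)
  ultimately have "policy_value ?M (\<lambda>_. \<theta>) 0 \<le> optimal_value ?M 0"
    using S by (auto simp: optimal_stationary_def optimal_value_def)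
  then show ?thesis using S by (simp add: policy_value_planted_opt[OF assms])
qed

lemma return_scale_planted_le:
  assumes "2 / p\<^sup>2 \<le> u\<^sup>2" "0 \<le> u"
  shows "return_scale (bandit_sp S A (planted p d \<theta>)) \<le> ennreal u"
  unfolding return_scale_def
proof (rule SUP_least)
  fix \<pi> assume "\<pi> \<in> HD_policies (bandit_sp S A (planted p d \<theta>))"
  then interpret bandit_learner S A 0 "\<lambda>h x. return_pmf (\<pi> h x)"
    using S by (intro bandit_learner_policy) auto
  let ?x = "\<integral>\<^sup>+\<omega>. ennreal ((episode_return (reward (bandit_sp S A (planted p d \<theta>))) \<omega> 0)\<^sup>2)
    \<partial>policy_run (bandit_sp S A (planted p d \<theta>)) \<pi> (init (bandit_sp S A (planted p d \<theta>)))"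
  have "?x \<le> ennreal (2 / p\<^sup>2)"
    using nn_integral_return_sq[OF summable_unfinished[OF pd, of \<theta> 1]] second_moment_le[OF pd, of \<theta>]
    by (simp add: policy_run_def)
  also have "\<dots> \<le> ennreal (u\<^sup>2)" using assms(1) by (rule ennreal_leI)
  finally have x: "?x \<le> ennreal (u\<^sup>2)" .
  then have "?x < \<infinity>" by (rule le_less_trans) simp
  then have "?x \<noteq> \<infinity>" by simp
  moreover have "enn2real ?x \<le> u\<^sup>2"
    using x by (intro enn2real_leI) auto
  then have "sqrt (enn2real ?x) \<le> u"
    using assms(2) real_le_lsqrt by simp
  ultimately show "ennreal_sqrt ?x \<le> ennreal u"
    by (auto simp: ennreal_sqrt_def intro: ennreal_leI)
qed

text \<open>The benchmark is at least \<open>K / p\<close>, while the learner's expected total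
  length is at most \<open>K / p\<close> minus \<open>d\<close> times its expected misses.\<close>

lemma expected_regret_planted_ge:
  assumes "\<theta> \<in> {..<S} \<rightarrow> {..<A}" "learning_algorithm {..<S} {..<A} L"
  defines "\<sigma> \<equiv> L (\<lambda>_ _. 1)"
  shows "d * (\<Sum>t<n. measure_pmf.expectation (history_pmf (bandit_sp S A (planted p d \<theta>)) 0 \<sigma> t)
      (\<lambda>h. of_bool (terminations h < K) * bandit_learner.wrong 0 \<sigma> \<theta> h))
    \<le> expected_regret (bandit_sp S A (planted p d \<theta>)) K L"
proof -
  interpret bandit_learner S A 0 \<sigma>
    using assms S by unfold_locales (auto simp: learning_algorithm_def)
  let ?M = "bandit_sp S A (planted p d \<theta>)"
  have "expected_regret ?M K L = real K * optimal_value ?M 0 - (\<Sum>t. unfinished ?M 0 \<sigma> K t)"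
    using has_bochner_integral_regret[OF _ summable_unfinished[OF pd, of \<theta> K]]
    by (simp add: expected_regret_def has_bochner_integral_iff \<sigma>_def)
  moreover have "real K / p \<le> real K * optimal_value ?M 0"
    using mult_left_mono[OF optimal_value_planted_ge[OF assms(1)], of "real K"] by simp
  ultimately show ?thesis
    using suminf_unfinished_le[OF pd, of \<theta> K n] by linarith
qed

end

section \<open>Choice of parameters and averaging over the secrets\<close>

lemma expected_regret_average_ge:
  fixes S A K :: nat and u :: real
  assumes u: "2 \<le> u" and S: "1 \<le> S" and A: "2 \<le> A" and K: "64 * real S * real A \<le> real K"
    and L: "learning_algorithm {..<S} {..<A} L"
  defines "p \<equiv> 3 / (2 * u)" and "d \<equiv> sqrt (real S * real A / real K) / 32"
  shows "u * sqrt (real S * real A * real K) / 200000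
    \<le> measure_pmf.expectation (map_pmf (\<lambda>\<theta>. bandit_sp S A (planted p d \<theta>)) (pmf_of_set (PiE {..<S} (\<lambda>_. {..<A}))))
        (\<lambda>M. expected_regret M K L)"
proof -
  let ?\<Theta> = "PiE {..<S} (\<lambda>_. {..<A})"
  let ?M = "\<lambda>\<theta>. bandit_sp S A (planted p d \<theta>)"
  define \<sigma> where "\<sigma> = L (\<lambda>_ _. 1)"
  interpret bandit_learner S A 0 \<sigma>
    using L S by unfold_locales (auto simp: learning_algorithm_def \<sigma>_def)
  define N where "N = real (card ?\<Theta>)"
  have fin: "finite ?\<Theta>" by (intro finite_PiE) auto
  have ne: "?\<Theta> \<noteq> {}" using A by (auto simp: PiE_eq_empty_iff lessThan_empty_iff)
  have N: "0 < N" using fin ne by (simp add: N_def card_gt_0_iff)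
  have SA: "1 \<le> real S * real A" using mult_mono[of 1 "real S" 1 "real A"] S A by simp
  have Kpos: "0 < real K" using K SA by simp
  have d2: "d\<^sup>2 = real S * real A / (1024 * real K)"
    by (simp add: d_def power_divide)
  have "real S * real A / (1024 * real K) \<le> (1 / 24)\<^sup>2"
    using K SA Kpos by (simp add: field_simps)
  then have d: "0 \<le> d" "d \<le> 1 / 24"
    using power2_le_imp_le[of d "1 / 24"] by (simp_all add: d2) (simp add: d_def)
  have p: "0 < p" "p \<le> 3 / 4" using u by (auto simp: p_def field_simps)
  have pd: "0 < p" "0 \<le> d" "p * (1 + d) < 1"
    using p d mult_mono[of p "3/4" "1 + d" "25/24"] by auto
  \<comment> \<open>The horizon is a 64th of \<open>K / p\<close>, so few episodes are over by then.
    With \<open>d\<^sup>2 = S A / (1024 K)\<close> and \<open>1 - p \<ge> 1 / 4\<close> the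
    information term is at most \<open>S A / 128\<close>.\<close>
  define x where "x = real K / (64 * p)"
  define m where "m = nat \<lfloor>x\<rfloor>"
  have x: "1 \<le> x"
    using K SA p by (simp add: x_def field_simps)
  \<comment> \<open>Rounding down loses at most a factor 2 because \<open>1 \<le> x\<close>.\<close>
  have m: "real m \<le> x" "x / 2 \<le> real m" 
  proof -
    have "1 \<le> \<lfloor>x\<rfloor>" using x by simp
    then have "1 \<le> real m" "real m = real_of_int \<lfloor>x\<rfloor>" by (simp_all add: m_def)
    then show "real m \<le> x" "x / 2 \<le> real m" by linarith+
  qed
  define G where "G \<theta> = (\<Sum>t<Suc m. E (planted p d \<theta>) t (\<lambda>h. of_bool (terminations h < K) * wrong \<theta> h))" for \<theta>
  have "real m * (N / 32) = (\<Sum>n<m. N / 32)" by simp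
  also have "\<dots> \<le> (\<Sum>n<m. \<Sum>\<theta>\<in>?\<Theta>. E (planted p d \<theta>) (Suc n) (\<lambda>h. of_bool (terminations h < K) * wrong \<theta> h))"
    unfolding N_def
  proof (intro sum_mono average_wrong_pulls_ge[OF p d A])
    show "0 < K" using Kpos by simp
    fix n assume "n \<in> {..<m}"
    then have n: "real (Suc n) \<le> x" using m by simp
    then show "real (Suc n) * p \<le> real K / 64"
      using p by (simp add: x_def field_simps)
    have "p * d\<^sup>2 / (1 - p) \<le> p * d\<^sup>2 / (1 / 4)"
      using p by (intro divide_left_mono) auto
    then have "128 * (p * d\<^sup>2 / (1 - p)) * real (Suc n) \<le> 128 * (p * d\<^sup>2 / (1 / 4)) * x"
      using n p by (intro mult_mono) auto
    also have "\<dots> = real S * real A / 128"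
      using p Kpos by (simp add: d2 x_def)
    also have "\<dots> \<le> real S * real A / 64" using SA by simp
    finally show "128 * (p * d\<^sup>2 / (1 - p)) * real (Suc n) \<le> real S * real A / 64" .
  qed
  also have "\<dots> = (\<Sum>\<theta>\<in>?\<Theta>. \<Sum>n<m. E (planted p d \<theta>) (Suc n) (\<lambda>h. of_bool (terminations h < K) * wrong \<theta> h))"
    by (rule sum.swap)
  \<comment> \<open>The estimates begin after one step, since a jump must have occurred; the extra
    term for the empty history is nonnegative.\<close>
  also have "\<dots> \<le> (\<Sum>\<theta>\<in>?\<Theta>. G \<theta>)"
    unfolding G_def sum.lessThan_Suc_shift
    by (intro sum_mono) (simp add: wrong_bounds)
  finally have G: "real m * (N / 32) \<le> (\<Sum>\<theta>\<in>?\<Theta>. G \<theta>)" .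
  \<comment> \<open>The exact constant is
    \<open>2 / (3 * 32 * 64 * 64) = 1 / 196608\<close>.\<close>
  have "u * sqrt (real S * real A * real K) / 200000 \<le> d * (x / 64)"
  proof -
    have "sqrt (real S * real A * real K) = sqrt (real S * real A / real K) * real K"
      using Kpos by (simp add: real_sqrt_divide real_sqrt_mult real_div_sqrt field_simps)
    then have "d * (x / 64) = u * sqrt (real S * real A * real K) / 196608"
      using u by (simp add: d_def x_def p_def field_simps)
    moreover have "0 \<le> u * sqrt (real S * real A * real K)" using u by simp
    ultimately show ?thesis by linarith
  qed
  also have "\<dots> \<le> d * (real m / 32)"
    using m d by (intro mult_left_mono) auto
  also have "\<dots> \<le> d * ((\<Sum>\<theta>\<in>?\<Theta>. G \<theta>) / N)"
    using G N d by (intro mult_left_mono) (auto simp: field_simps)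
  also have "\<dots> = (\<Sum>\<theta>\<in>?\<Theta>. d * G \<theta>) / N"
    by (simp add: sum_distrib_left)
  also have "\<dots> \<le> (\<Sum>\<theta>\<in>?\<Theta>. expected_regret (?M \<theta>) K L) / N"
    using N expected_regret_planted_ge[OF pd S _ _ L, where n="Suc m" and K=K] A
    by (intro divide_right_mono sum_mono) (auto simp: G_def \<sigma>_def PiE_def)
  also have "\<dots> = measure_pmf.expectation (map_pmf ?M (pmf_of_set ?\<Theta>)) (\<lambda>M. expected_regret M K L)"
    using fin ne by (simp add: integral_pmf_of_set N_def)
  finally show ?thesis .
qed

theorem theorem3:
  shows "\<exists>c\<^sub>0 > 0. \<exists>c > 0. \<forall>(u::real) (S::nat) (A::nat) (K::nat).
    u \<ge> 2 \<longrightarrow> S \<ge> 1 \<longrightarrow> A \<ge> 2 \<longrightarrow> real K \<ge> c\<^sub>0 * real S * real A \<longrightarrow>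
    (\<exists>\<M> :: (nat, nat) sp set.
       (\<forall>M\<in>\<M>. sp_instance M \<and> states M = {..<S} \<and> actions M = {..<A} \<and>
                return_scale M \<le> ennreal u) \<and>
       (\<exists>D :: (nat, nat) sp pmf. set_pmf D \<subseteq> \<M> \<and>
          (\<forall>L. learning_algorithm {..<S} {..<A} L \<longrightarrow>
             measure_pmf.expectation D (\<lambda>M. expected_regret M K L)
               \<ge> c * u * sqrt (real S * real A * real K))))"
proof (rule exI[of _ 64], rule conjI, simp, rule exI[of _ "1 / 200000"], rule conjI, simp, intro allI impI)
  fix u :: real and S A K :: nat
  assume u: "u \<ge> 2" and S: "S \<ge> 1" and A: "A \<ge> 2" and K: "real K \<ge> 64 * real S * real A"
  define p d where "p = 3 / (2 * u)" and "d = sqrt (real S * real A / real K) / 32"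
  let ?M = "\<lambda>\<theta>. bandit_sp S A (planted p d \<theta>)"
  let ?D = "map_pmf ?M (pmf_of_set (PiE {..<S} (\<lambda>_. {..<A})))"
  have p: "0 < p" "p \<le> 3 / 4" using u by (auto simp: p_def field_simps)
  have "real S * real A \<le> real K" using K by (simp add: mult.assoc)
  then have d: "0 \<le> d" "d \<le> 1 / 32"
    using divide_le_eq_1[of "real S * real A" "real K"] by (auto simp: d_def)
  have pd: "0 < p" "0 \<le> d" "p * (1 + d) < 1"
    using p d mult_mono[of p "3/4" "1 + d" "33/32"] by auto
  \<comment> \<open>The choice of \<open>p\<close> gives
    \<open>2 / p\<^sup>2 = 8 * u\<^sup>2 / 9\<close>.\<close>
  have "2 / p\<^sup>2 \<le> u\<^sup>2" using u by (simp add: p_def power_divide)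
  \<comment> \<open>The set admits every function \<open>\<theta>\<close>; the prior charges only
    those whose secrets are among the \<open>A\<close> actions.\<close>
  then have "\<forall>M\<in>range ?M. sp_instance M \<and> states M = {..<S} \<and> actions M = {..<A} \<and> return_scale M \<le> ennreal u"
    using sp_instance_planted[OF pd S] return_scale_planted_le[OF pd S] A u by auto
  moreover have "set_pmf ?D \<subseteq> range ?M" by auto
  moreover have "1 / 200000 * u * sqrt (real S * real A * real K)
      \<le> measure_pmf.expectation ?D (\<lambda>M. expected_regret M K L)"
    if "learning_algorithm {..<S} {..<A} L" for L
    using expected_regret_average_ge[OF u S A K that] by (simp add: p_def d_def)
  ultimately show "\<exists>\<M> :: (nat, nat) sp set.
       (\<forall>M\<in>\<M>. sp_instance M \<and> states M = {..<S} \<and> actions M = {..<A} \<and> return_scale M \<le> ennreal u) \<and>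
       (\<exists>D :: (nat, nat) sp pmf. set_pmf D \<subseteq> \<M> \<and>
          (\<forall>L. learning_algorithm {..<S} {..<A} L \<longrightarrow>
             measure_pmf.expectation D (\<lambda>M. expected_regret M K L)
               \<ge> 1 / 200000 * u * sqrt (real S * real A * real K)))"
    by blast
qed

end
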